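(* Let $\mathcal{G}$ be the three-dimensional cubic grid with edge length $\ell>0$. For every $p\in\left[\frac{10}{3},6\right]$ there exists a constant $C_p>0$, depending on $p$, such that $$\|\psi\|_{L^p(\mathcal{G})}^p\leq C_p\,\|\psi\|_{L^2(\mathcal{G})}^{p-2}\,\|\psi'\|_{L^2(\mathcal{G})}^{2}\qquad\text{for all }\psi\in H^1(\mathcal{G}).$$
   Context: Fix $\ell>0$ (constants may depend on $\ell$). The three-dimensional grid $\mathcal{G}$ is the metric graph embedded in $\mathbb{R}^3$ with vertex set $\{(i\ell,j\ell,k\ell): (i,j,k)\in\mathbb{Z}^3\}$ and whose edges are the segments of length $\ell$ joining nearest-neighbour vertices (parallel to the coordinate axes). Equivalently $\mathcal{G}$ is the union of the lines $X_{j,k}=\mathbb{R}\times\{j\ell\}\times\{k\ell\}$, $Y_{i,k}=\{i\ell\}\times\mathbb{R}\times\{k\ell\}$, $Z_{i,j}=\{i\ell\}\times\{j\ell\}\times\mathbb{R}$, for $i,j,k\in\mathbb{Z}$. Functions on $\mathcal{G}$ are complex-valued, and $\psi'$ denotes the derivative along each line with respect to arc length. The norms are $$\|\psi\|_{L^p(\mathcal{G})}^p=\sum_{(j,k)\in\mathbb{Z}^2}\int_{X_{j,k}}|\psi|^p\,dx+\sum_{(i,k)\in\mathbb{Z}^2}\int_{Y_{i,k}}|\psi|^p\,dx+\sum_{(i,j)\in\mathbb{Z}^2}\int_{Z_{i,j}}|\psi|^p\,dx,$$ and $\|\psi\|_{H^1(\mathcal{G})}^2=\|\psi\|_{L^2(\mathcal{G})}^2+\|\psi'\|_{L^2(\mathcal{G})}^2$.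 The space $H^1(\mathcal{G})$ consists of the functions whose restriction to every line $X_{j,k},Y_{i,k},Z_{i,j}$ belongs to $H^1(\mathbb{R})$, which are continuous at every vertex of $\mathcal{G}$, and for which $\|\psi\|_{H^1(\mathcal{G})}<\infty$. *)

theory Defs
  imports "HOL-Analysis.Analysis"
begin

section \<open>The Sobolev space on the real line\<close>

definition test_function :: "(real \<Rightarrow> real) \<Rightarrow> bool" where
  "test_function \<phi> \<longleftrightarrow>
     (\<forall>n. (deriv ^^ n) \<phi> differentiable_on UNIV) \<and> compact (closure {x. \<phi> x \<noteq> 0})"

definition L2_real :: "(real \<Rightarrow> complex) set" where
  "L2_real = {u. u \<in> borel_measurable lebesgue \<and> integrable lebesgue (\<lambda>x. (norm (u x))\<^sup>2)}"

definition has_weak_deriv :: "(real \<Rightarrow> complex) \<Rightarrow> (real \<Rightarrow> complex) \<Rightarrow> bool" where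
  "has_weak_deriv u g \<longleftrightarrow>
     (\<forall>\<phi>. test_function \<phi> \<longrightarrow>
        (LINT x|lebesgue. deriv \<phi> x *\<^sub>R u x) = - (LINT x|lebesgue. \<phi> x *\<^sub>R g x))"

definition H1_real :: "(real \<Rightarrow> complex) set" where
  "H1_real = {u \<in> L2_real. \<exists>g\<in>L2_real. has_weak_deriv u g}"

text \<open>The weak derivative is unique only up to null sets; a representative is chosen,
  which is meaningful for arguments in \<^const>\<open>H1_real\<close>.\<close>

definition weak_deriv :: "(real \<Rightarrow> complex) \<Rightarrow> real \<Rightarrow> complex" where
  "weak_deriv u = (SOME g. g \<in> L2_real \<and> has_weak_deriv u g)"


section \<open>The cubic grid\<close>

datatype direction = X | Y | Z

text \<open>\<open>grid_line l d (m, n)\<close> is the arc length parametrisation of the line in direction \<open>d\<close>;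
  \<open>(m, n)\<close> are the indices of the two fixed coordinates in increasing order, that is,
  \<open>(j, k)\<close>, \<open>(i, k)\<close>, \<open>(i, j)\<close> for the lines $X_{j,k}$, $Y_{i,k}$, $Z_{i,j}$.\<close>

fun grid_line :: "real \<Rightarrow> direction \<Rightarrow> int \<times> int \<Rightarrow> real \<Rightarrow> real^3" where
  "grid_line l X (j, k) t = vector [t, of_int j * l, of_int k * l]"
| "grid_line l Y (i, k) t = vector [of_int i * l, t, of_int k * l]"
| "grid_line l Z (i, j) t = vector [of_int i * l, of_int j * l, t]"

definition grid :: "real \<Rightarrow> (real^3) set" where
  "grid l = (\<Union>d. \<Union>mn. range (grid_line l d mn))"

definition grid_vertices :: "real \<Rightarrow> (real^3) set" where
  "grid_vertices l = {vector [of_int i * l, of_int j * l, of_int k * l] | i j k. True}"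


section \<open>Norms and the Sobolev space on the grid\<close>

text \<open>At a vertex the derivative depends on the line along which it is taken, so \<open>\<psi>'\<close> is not a
  function on the grid. The norms are therefore defined for families consisting of one function
  for each line; a function \<open>\<psi>\<close> on the grid enters through its restrictions to the lines.
  Functions on the grid are represented by functions on \<open>\<real>\<^sup>3\<close> whose values off the grid are never
  used.\<close>

type_synonym line_family = "direction \<Rightarrow> int \<times> int \<Rightarrow> real \<Rightarrow> complex"

definition grid_restr :: "real \<Rightarrow> (real^3 \<Rightarrow> complex) \<Rightarrow> line_family" where
  "grid_restr l \<psi> = (\<lambda>d mn t. \<psi> (grid_line l d mn t))"

definition grid_deriv :: "real \<Rightarrow> (real^3 \<Rightarrow> complex) \<Rightarrow> line_family" where
  "grid_deriv l \<psi> = (\<lambda>d mn. weak_deriv (grid_restr l \<psi> d mn))"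

text \<open>The \<open>p\<close>-th power of the \<open>L\<^sup>p\<close> norm, possibly infinite.\<close>

definition Lp_norm_pow :: "real \<Rightarrow> line_family \<Rightarrow> ennreal" where
  "Lp_norm_pow p f =
       (\<Sum>\<^sub>\<infinity>jk\<in>UNIV. \<integral>\<^sup>+x. ennreal (norm (f X jk x) powr p) \<partial>lebesgue)
     + (\<Sum>\<^sub>\<infinity>ik\<in>UNIV. \<integral>\<^sup>+y. ennreal (norm (f Y ik y) powr p) \<partial>lebesgue)
     + (\<Sum>\<^sub>\<infinity>ij\<in>UNIV. \<integral>\<^sup>+z. ennreal (norm (f Z ij z) powr p) \<partial>lebesgue)"

text \<open>The real-valued \<open>L\<^sup>2\<close> norm. It is meaningful only if \<^term>\<open>Lp_norm_pow 2 f < \<infinity>\<close>, since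
  \<^const>\<open>enn2real\<close> sends \<open>\<infinity>\<close> to \<open>0\<close>.\<close>

definition L2_norm :: "line_family \<Rightarrow> real" where
  "L2_norm f = sqrt (enn2real (Lp_norm_pow 2 f))"

definition H1_grid :: "real \<Rightarrow> (real^3 \<Rightarrow> complex) set" where
  "H1_grid l = {\<psi>.
     (\<forall>d mn. grid_restr l \<psi> d mn \<in> H1_real) \<and>
     (\<forall>v\<in>grid_vertices l. continuous (at v within grid l) \<psi>) \<and>
     Lp_norm_pow 2 (grid_restr l \<psi>) + Lp_norm_pow 2 (grid_deriv l \<psi>) < \<infinity>}"

end

theory Submission
  imports Defs
begin

text \<open>
  A function on the grid looks one-dimensional at scales below \<open>l\<close> and three-dimensional at scales
  above \<open>l\<close>. Write \<open>M\<close> and \<open>D\<close> for the squared \<open>L\<^sup>2\<close> norms of \<open>\<psi>\<close> and \<open>\<psi>'\<close>, and \<open>T\<close> for the sixth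
  power of the \<open>L\<^sup>6\<close> norm of \<open>\<psi>\<close>. Each picture gives a bound on \<open>T\<close>.

  The one-dimensional bound \<open>T \<le> 16 M\<^sup>2 D\<close> (\<open>L6_le_one_dimensional\<close>) comes from the Gagliardo-Nirenberg
  inequality for the supremum on each single line. The three-dimensional bound \<open>T \<le> K D\<^sup>3\<close>
  (\<open>L6_le_three_dimensional\<close>) is Sobolev's inequality. It is reduced to the vertices: on an edge,
  the squared difference between \<open>\<psi>\<close> and its value at an end point is at most \<open>l\<close> times the integral of
  \<open>|\<psi>'|\<^sup>2\<close> over the edge, so it suffices to bound the \<open>\<ell>\<^sup>6\<close> norm of a function on \<open>\<int>\<^sup>3\<close> by the \<open>\<ell>\<^sup>2\<close> norm of its
  differences (\<open>discrete_Sobolev\<close>). This follows from the Loomis-Whitney inequality, applied to the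
  variation of the fourth power of the function along the lines, as in the classical proof of
  Gagliardo and Nirenberg.

  The theorem is an interpolation. Put \<open>\<theta> = (p - 2) / 4\<close>. By Hoelder's inequality between the
  exponents \<open>2\<close> and \<open>6\<close>, the \<open>p\<close>-th power of the \<open>L\<^sup>p\<close> norm is at most
  \<open>M\<close> to the power \<open>1 - \<theta>\<close> times \<open>T\<close> to the power \<open>\<theta>\<close>. In the second factor, the three-dimensional bound is
  used to the power \<open>s\<close> and the one-dimensional bound to the power \<open>\<theta> - s\<close>. The total exponent of \<open>D\<close> is
  then \<open>2 s + \<theta>\<close>, which is \<open>1\<close> for \<open>s = (1 - \<theta>) / 2\<close>, and \<open>0 \<le> s \<le> \<theta>\<close> says precisely that
  \<open>10/3 \<le> p \<le> 6\<close> (\<open>Lp_norm_pow_interpolation\<close>).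

  All analysis on a line rests on one consequence of weak differentiability
  (\<open>weak_deriv_Hoelder_estimate\<close>): for almost all points, the square of \<open>|u x - u y|\<close> is at most the
  length times the energy, the integral of \<open>|u'|\<^sup>2\<close>, of any interval that contains \<open>x\<close> and \<open>y\<close> with room
  to spare. It is obtained by testing the weak derivative with functions that compare averages of \<open>u\<close>
  near \<open>x\<close> and near \<open>y\<close>. Continuity at the vertices extends it from almost every point to the vertices
  themselves, where the lines meet.
\<close>

section \<open>Smooth bump functions\<close>

text \<open>With \<open>P = 1\<close> this is the standard smooth function that vanishes to infinite order at \<open>0\<close>. The
  polynomial factor makes the family closed under differentiation.\<close>

definition flat :: "real poly \<Rightarrow> real \<Rightarrow> real" where
  "flat P t = (if t > 0 then poly P (1 / t) * exp (- 1 / t) else 0)"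

lemma poly_times_exp_tendsto_0:
  fixes P :: "real poly"
  shows "((\<lambda>s. poly P s * exp (- s)) \<longlongrightarrow> 0) at_top"
proof -
  have "((\<lambda>s. \<Sum>i\<le>degree P. coeff P i * (s ^ i / exp s)) \<longlongrightarrow> (\<Sum>i\<le>degree P. coeff P i * 0)) at_top"
    by (intro tendsto_intros tendsto_power_div_exp_0)
  then show ?thesis
    by (simp add: poly_altdef sum_distrib_left sum_distrib_right exp_minus divide_inverse mult_ac)
qed

text \<open>The new polynomial comes from the chain rule with \<open>s = 1 / t\<close>, which contributes the factor \<open>s\<^sup>2\<close>.
  At \<open>0\<close> the difference quotient is again a polynomial in \<open>1 / t\<close> times \<open>exp (- 1 / t)\<close>, and the
  exponential wins.\<close>

lemma flat_has_derivative:
  "DERIV (flat P) t :> flat (monom 1 2 * (P - pderiv P)) t"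
proof (cases t "0::real" rule: linorder_cases)
  case less
  have "DERIV (\<lambda>_. 0) t :> 0" by simp
  then have "DERIV (flat P) t :> 0"
  proof (rule DERIV_cong_ev[THEN iffD1, rotated -1])
    show "\<forall>\<^sub>F x in nhds t. 0 = flat P x"
      using eventually_nhds_in_open[of "{..<0}" t] less
      by (auto elim!: eventually_mono simp: flat_def)
  qed auto
  then show ?thesis using less by (simp add: flat_def)
next
  case greater
  have "DERIV (\<lambda>t. poly P (1 / t) * exp (- 1 / t)) t :>
     poly (monom 1 2 * (P - pderiv P)) (1 / t) * exp (- 1 / t)"
  proof -
    have "DERIV (\<lambda>t. 1 / t) t :> - (1 / t\<^sup>2)" "DERIV (\<lambda>t. - 1 / t) t :> 1 / t\<^sup>2"
      using greater by (auto intro!: derivative_eq_intros simp: power2_eq_square)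
    from DERIV_mult[OF DERIV_chain2[OF poly_DERIV this(1)] DERIV_chain2[OF DERIV_exp this(2)]]
    show ?thesis
      by (rule DERIV_cong) (simp add: poly_monom field_simps power2_eq_square)
  qed
  then have "DERIV (flat P) t :> poly (monom 1 2 * (P - pderiv P)) (1 / t) * exp (- 1 / t)"
  proof (rule DERIV_cong_ev[THEN iffD1, rotated -1])
    show "\<forall>\<^sub>F x in nhds t. poly P (1 / x) * exp (- 1 / x) = flat P x"
      using eventually_nhds_in_open[of "{0<..}" t] greater
      by (auto elim!: eventually_mono simp: flat_def)
  qed auto
  then show ?thesis using greater by (simp add: flat_def)
next
  case equal
  have "((\<lambda>h. flat P h / h) \<longlongrightarrow> 0) (at_left 0)"
    by (rule tendsto_eventually) (auto simp: eventually_at_filter flat_def)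
  moreover have "((\<lambda>h. flat P h / h) \<longlongrightarrow> 0) (at_right 0)"
  proof -
    have "((\<lambda>h. poly (pCons 0 P) (inverse h) * exp (- inverse h)) \<longlongrightarrow> 0) (at_right (0::real))"
      by (rule filterlim_compose[OF poly_times_exp_tendsto_0 filterlim_inverse_at_top_right])
    moreover have "\<forall>\<^sub>F h in at_right 0. poly (pCons 0 P) (inverse h) * exp (- inverse h) = flat P h / h"
      by (auto simp: eventually_at_filter flat_def field_simps)
    ultimately show ?thesis by (rule Lim_transform_eventually)
  qed
  ultimately have "((\<lambda>h. flat P h / h) \<longlongrightarrow> 0) (at 0)"
    by (rule filterlim_split_at)
  then show ?thesis using equal by (simp add: DERIV_def flat_def)
qed

text \<open>A class that contains the building blocks of bump functions and whose members all have a derivative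
  in the class. Membership therefore implies smoothness, and it is checked syntactically.\<close>

inductive flat_generated :: "(real \<Rightarrow> real) \<Rightarrow> bool" where
  flat: "flat_generated (flat P)"
| const: "flat_generated (\<lambda>_. c)"
| add: "flat_generated f \<Longrightarrow> flat_generated g \<Longrightarrow> flat_generated (\<lambda>t. f t + g t)"
| mult: "flat_generated f \<Longrightarrow> flat_generated g \<Longrightarrow> flat_generated (\<lambda>t. f t * g t)"
| affine: "flat_generated f \<Longrightarrow> flat_generated (\<lambda>t. f (c * t + d))"

lemma flat_generated_derivative:
  "flat_generated f \<Longrightarrow> \<exists>f'. flat_generated f' \<and> (\<forall>t. DERIV f t :> f' t)"
proof (induction rule: flat_generated.induct)
  case (flat P)
  show ?case using flat_has_derivative flat_generated.flat by blast
next
  case (const c)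
  show ?case using flat_generated.const[of 0] DERIV_const[of c] by blast
next
  case (add f g)
  then obtain f' g' where "flat_generated f'" "\<forall>t. DERIV f t :> f' t"
    "flat_generated g'" "\<forall>t. DERIV g t :> g' t" by blast
  then show ?case
    using flat_generated.add[of f' g'] DERIV_add[of f _ _ UNIV g] by blast
next
  case (mult f g)
  then obtain f' g' where "flat_generated f'" "\<forall>t. DERIV f t :> f' t"
    "flat_generated g'" "\<forall>t. DERIV g t :> g' t" by blast
  with mult show ?case
    using flat_generated.add[OF flat_generated.mult[of f' g] flat_generated.mult[of g' f]]
      DERIV_mult[of f _ _ UNIV g] by blast
next
  case (affine f c d)
  then obtain f' where f': "flat_generated f'" "\<forall>t. DERIV f t :> f' t" by blast
  have "DERIV (\<lambda>t. c * t + d) t :> c" for t by (auto intro!: derivative_eq_intros)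
  then have "DERIV (\<lambda>t. f (c * t + d)) t :> f' (c * t + d) * c" for t
    using f'(2) by (intro DERIV_chain2[of f]) auto
  moreover have "flat_generated (\<lambda>t. f' (c * t + d) * c)"
    by (rule flat_generated.mult[OF flat_generated.affine[OF f'(1)] flat_generated.const])
  ultimately show ?case by blast
qed

lemma flat_generated_smooth:
  assumes "flat_generated f"
  shows "(deriv ^^ n) f differentiable_on UNIV"
proof -
  have "flat_generated ((deriv ^^ n) f)"
  proof (induction n)
    case (Suc n)
    from flat_generated_derivative[OF this] obtain f' where
      "flat_generated f'" "\<forall>t. DERIV ((deriv ^^ n) f) t :> f' t" by blast
    moreover from this have "deriv ((deriv ^^ n) f) = f'"
      by (auto intro!: DERIV_imp_deriv)
    ultimately show ?case by simp
  qed (use assms in simp)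
  then show ?thesis
    using flat_generated_derivative
    by (meson differentiable_at_imp_differentiable_on field_differentiable_def field_differentiable_imp_differentiable)
qed

text \<open>For large \<open>n\<close> this smooth function is close to the indicator of \<open>(0, h)\<close>: both factors then take
  arguments at which \<open>exp (- 1 / s)\<close> is close to \<open>1\<close>.\<close>

definition bump :: "real \<Rightarrow> nat \<Rightarrow> real \<Rightarrow> real" where
  "bump h n t = flat 1 (real n * t) * flat 1 (real n * (h - t))"

lemma bump_bounds: "0 \<le> bump h n t" "bump h n t \<le> 1"
  by (auto simp: bump_def flat_def intro!: mult_le_one)

lemma bump_eq_0: "t \<le> 0 \<or> t \<ge> h \<Longrightarrow> bump h n t = 0"
  by (auto simp: bump_def flat_def mult_nonneg_nonpos zero_less_mult_iff)

lemma bump_tendsto_indicator: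
  "(\<lambda>n. bump h n t) \<longlonglongrightarrow> indicator {0<..<h} t"
proof (cases "0 < t \<and> t < h")
  case True
  have 1: "(\<lambda>n. flat 1 (real n * s)) \<longlonglongrightarrow> 1" if "s > 0" for s
  proof -
    have "(\<lambda>n. exp (- (inverse s) * (1 / real n))) \<longlonglongrightarrow> exp (- inverse s * 0)"
      by (intro tendsto_intros lim_1_over_n)
    then have "(\<lambda>n. exp (- (inverse s) * (1 / real n))) \<longlonglongrightarrow> 1" by simp
    moreover have "\<forall>\<^sub>F n in sequentially. exp (- (inverse s) * (1 / real n)) = flat 1 (real n * s)"
      using eventually_gt_at_top[of 0] by eventually_elim (use that in \<open>auto simp: flat_def field_simps\<close>)
    ultimately show ?thesis by (rule Lim_transform_eventually)
  qed
  have "(\<lambda>n. flat 1 (real n * t) * flat 1 (real n * (h - t))) \<longlonglongrightarrow> 1 * 1"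
    using True by (intro tendsto_mult 1) auto
  with True show ?thesis by (simp add: bump_def)
next
  case False
  then show ?thesis by (auto simp: bump_eq_0 not_less)
qed

lemma bump_flat_generated: "flat_generated (\<lambda>t. bump h n (t - x))"
proof -
  have "flat_generated (\<lambda>t. flat 1 (real n * t + real n * (- x)) * flat 1 (- real n * t + real n * (h + x)))"
    by (intro flat_generated.mult flat_generated.affine flat_generated.flat)
  then show ?thesis by (simp add: bump_def algebra_simps)
qed

lemma bump_borel_measurable: "(\<lambda>t. bump h n (t - x)) \<in> borel_measurable lebesgue"
proof -
  have "isCont (\<lambda>t. bump h n (t - x)) t" for t
    using flat_generated_derivative[OF bump_flat_generated[of h n x]] DERIV_isCont by blast
  then have "(\<lambda>t. bump h n (t - x)) \<in> borel_measurable borel"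
    by (intro borel_measurable_continuous_onI continuous_at_imp_continuous_on) auto
  then show ?thesis by (simp add: measurable_completion)
qed

text \<open>Let \<open>E\<close> be an antiderivative of the bump. It is constant on either side of \<open>[0, h]\<close>, so the
  difference of two translates of \<open>E\<close> has compact support, although \<open>E\<close> has not. As \<open>n\<close> grows, its
  derivative approaches the indicator of \<open>(x, x + h)\<close> minus that of \<open>(y, y + h)\<close>. Testing a weak
  derivative with it compares the averages of the function over these two intervals.\<close>

lemma trapezoid_test_function:
  assumes "x < y" "0 < h"
  obtains \<phi> where "test_function \<phi>"
    "\<And>t. deriv \<phi> t = bump h n (t - x) - bump h n (t - y)"
    "\<And>t. 0 \<le> \<phi> t" "\<And>t. \<phi> t \<le> h" "\<And>t. t \<notin> {x..y + h} \<Longrightarrow> \<phi> t = 0"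
proof -
  have gen: "flat_generated (bump h n)" using bump_flat_generated[of h n 0] by simp
  have "isCont (bump h n) t" for t
    using flat_generated_derivative[OF gen] DERIV_isCont by blast
  then obtain E where E: "\<And>t. DERIV E t :> bump h n t"
    using einterval_antiderivative[of "-\<infinity>" "\<infinity>" "bump h n"]
    by (auto simp: has_real_derivative_iff_has_vector_derivative)
  have mono: "E s \<le> E t" if "s \<le> t" for s t
    by (rule DERIV_nonneg_imp_nondecreasing[OF that]) (use E bump_bounds in blast)
  have const: "E s = E t" if "s \<le> t" "\<And>r. s < r \<Longrightarrow> r < t \<Longrightarrow> bump h n r = 0" for s t
  proof (cases "s = t")
    case False
    have "continuous_on {s..t} E" using E by (meson DERIV_isCont continuous_at_imp_continuous_on)
    with False that show ?thesis
      using DERIV_isconst2[of s t E t] E by (metis order_le_less order_refl)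
  qed simp
  have left: "E t = E 0" if "t \<le> 0" for t
    using const[of t 0] that by (auto simp: bump_eq_0)
  have right: "E t = E h" if "t \<ge> h" for t
    using const[of h t] that by (auto simp: bump_eq_0)
  have total: "E h - E 0 \<le> h"
  proof -
    obtain z where "E h - E 0 = (h - 0) * bump h n z"
      using MVT2[of 0 h E "bump h n"] E assms by auto
    then show ?thesis using bump_bounds(2)[of h n z] assms by (simp add: mult_left_le)
  qed
  have range: "E 0 \<le> E t" "E t \<le> E h" for t
    using mono[of 0 t] left[of t] mono[of t h] right[of t] by linarith+
  define \<phi> where "\<phi> = (\<lambda>t. E (t - x) - E (t - y))"
  have der: "DERIV \<phi> t :> bump h n (t - x) - bump h n (t - y)" for t
  proof -
    have "DERIV (\<lambda>t. E (t - c)) t :> bump h n (t - c)" for c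
    proof -
      have "DERIV (\<lambda>t. t - c) t :> 1" by (auto intro!: derivative_eq_intros)
      from DERIV_chain2[OF E this] show ?thesis by simp
    qed
    then show ?thesis unfolding \<phi>_def by (intro DERIV_diff)
  qed
  have deriv: "deriv \<phi> = (\<lambda>t. bump h n (t - x) - bump h n (t - y))"
    using der DERIV_imp_deriv by blast
  have gen2: "flat_generated (deriv \<phi>)"
    using flat_generated.add[OF bump_flat_generated[of h n x]
        flat_generated.mult[OF flat_generated.const[of "-1"] bump_flat_generated[of h n y]]]
    by (simp add: deriv)
  have supp: "\<phi> t = 0" if "t \<notin> {x..y + h}" for t
    using that assms left[of "t - x"] left[of "t - y"] right[of "t - x"] right[of "t - y"]
    by (auto simp: \<phi>_def not_le)
  have "(deriv ^^ k) \<phi> differentiable_on UNIV" for k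
  proof (cases k)
    case 0
    then show ?thesis using der
      by (metis differentiable_at_imp_differentiable_on field_differentiable_def field_differentiable_imp_differentiable funpow_0)
  next
    case (Suc m)
    then show ?thesis using flat_generated_smooth[OF gen2, of m]
      by (simp add: funpow_Suc_right del: funpow.simps)
  qed
  moreover have "bounded {t. \<phi> t \<noteq> 0}"
    by (rule bounded_subset[OF bounded_closed_interval[of x "y + h"]]) (use supp in blast)
  ultimately have "test_function \<phi>" by (simp add: test_function_def)
  moreover have "0 \<le> \<phi> t" "\<phi> t \<le> h" for t
    using mono[of "t - y" "t - x"] range[of "t - x"] range[of "t - y"] total assms
    by (auto simp: \<phi>_def)
  ultimately show ?thesis using that supp deriv by metis
qed

section \<open>Weakly differentiable functions on a line\<close>

text \<open>Square integrable functions are locally integrable because \<open>r \<le> 1 + r\<^sup>2\<close>.\<close>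

lemma L2_real_integrable_on_interval:
  assumes "u \<in> L2_real"
  shows "integrable lebesgue (\<lambda>t. indicator {a..b} t *\<^sub>R u t)"
proof (rule Bochner_Integration.integrable_bound)
  have "integrable lebesgue (\<lambda>t. indicator {a..b} t :: real)"
    using emeasure_lborel_cbox_finite[of a b] by (simp add: integrable_indicator_iff emeasure_completion)
  then show "integrable lebesgue (\<lambda>t. indicator {a..b} t + (norm (u t))\<^sup>2)"
    using assms by (simp add: L2_real_def)
  show "(\<lambda>t. indicator {a..b} t *\<^sub>R u t) \<in> borel_measurable lebesgue"
    by (rule borel_measurable_scaleR[OF borel_measurable_indicator]) (use assms in \<open>auto simp: L2_real_def\<close>)
  have "r \<le> 1 + r\<^sup>2" for r :: real
    using zero_le_power2[of "r - 1/2"] by (simp add: power2_eq_square algebra_simps)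
  then show "AE t in lebesgue. norm (indicator {a..b} t *\<^sub>R u t) \<le> norm (indicator {a..b} t + (norm (u t))\<^sup>2)"
    by (auto simp: indicator_def)
qed

lemma bump_integral_tendsto:
  assumes "u \<in> L2_real"
  shows "(\<lambda>n. LINT t|lebesgue. bump h n (t - x) *\<^sub>R u t)
    \<longlonglongrightarrow> (LINT t|lebesgue. indicator {x<..<x + h} t *\<^sub>R u t)"
proof (rule integral_dominated_convergence)
  have m: "u \<in> borel_measurable lebesgue" using assms by (simp add: L2_real_def)
  show "(\<lambda>t. indicator {x<..<x + h} t *\<^sub>R u t) \<in> borel_measurable lebesgue"
    by (rule borel_measurable_scaleR[OF borel_measurable_indicator m]) simp
  show "(\<lambda>t. bump h n (t - x) *\<^sub>R u t) \<in> borel_measurable lebesgue" for n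
    by (rule borel_measurable_scaleR[OF bump_borel_measurable m])
  show "integrable lebesgue (\<lambda>t. norm (indicator {x..x + h} t *\<^sub>R u t))"
    using L2_real_integrable_on_interval[OF assms] by (rule integrable_norm)
  have "indicator {x<..<x + h} t = (indicator {0<..<h} (t - x) :: real)" for t
    by (auto simp: indicator_def)
  then show "AE t in lebesgue. (\<lambda>n. bump h n (t - x) *\<^sub>R u t) \<longlonglongrightarrow> indicator {x<..<x + h} t *\<^sub>R u t"
    by (auto intro!: tendsto_scaleR bump_tendsto_indicator)
  show "AE t in lebesgue. norm (bump h n (t - x) *\<^sub>R u t) \<le> norm (indicator {x..x + h} t *\<^sub>R u t)" for n
    using bump_bounds[of h n] bump_eq_0[of _ h n]
    by (auto simp: indicator_def mult_left_le_one_le not_le)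
qed

lemma weak_deriv_bump_difference:
  assumes u: "u \<in> L2_real" and g: "g \<in> L2_real" and w: "has_weak_deriv u g"
    and "x < y" "0 < h"
  shows "norm ((LINT t|lebesgue. bump h n (t - x) *\<^sub>R u t) - (LINT t|lebesgue. bump h n (t - y) *\<^sub>R u t))
    \<le> h * (LINT t|lebesgue. indicator {x..y + h} t * norm (g t))"
proof -
  obtain \<phi> where \<phi>: "test_function \<phi>"
    "\<And>t. deriv \<phi> t = bump h n (t - x) - bump h n (t - y)"
    "\<And>t. 0 \<le> \<phi> t" "\<And>t. \<phi> t \<le> h" "\<And>t. t \<notin> {x..y + h} \<Longrightarrow> \<phi> t = 0"
    using trapezoid_test_function[OF \<open>x < y\<close> \<open>0 < h\<close>] by metis
  have int: "integrable lebesgue (\<lambda>t. bump h n (t - c) *\<^sub>R u t)" for c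
  proof (rule Bochner_Integration.integrable_bound)
    show "integrable lebesgue (\<lambda>t. indicator {c..c + h} t *\<^sub>R u t)"
      using L2_real_integrable_on_interval[OF u] .
    show "(\<lambda>t. bump h n (t - c) *\<^sub>R u t) \<in> borel_measurable lebesgue"
      by (rule borel_measurable_scaleR[OF bump_borel_measurable]) (use u in \<open>simp add: L2_real_def\<close>)
    show "AE t in lebesgue. norm (bump h n (t - c) *\<^sub>R u t) \<le> norm (indicator {c..c + h} t *\<^sub>R u t)"
      using bump_bounds[of h n] bump_eq_0[of _ h n]
      by (auto simp: indicator_def mult_left_le_one_le not_le)
  qed
  have "(LINT t|lebesgue. bump h n (t - x) *\<^sub>R u t) - (LINT t|lebesgue. bump h n (t - y) *\<^sub>R u t)
      = (LINT t|lebesgue. deriv \<phi> t *\<^sub>R u t)"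
    using int by (simp add: \<phi>(2) scaleR_diff_left)
  also have "\<dots> = - (LINT t|lebesgue. \<phi> t *\<^sub>R g t)"
    using w \<phi>(1) by (simp add: has_weak_deriv_def)
  also have "norm \<dots> \<le> (LINT t|lebesgue. h * (indicator {x..y + h} t * norm (g t)))"
    unfolding norm_minus_cancel
  proof (rule order.trans[OF integral_norm_bound integral_mono'])
    show "integrable lebesgue (\<lambda>t. h * (indicator {x..y + h} t * norm (g t)))"
      using integrable_norm[OF L2_real_integrable_on_interval[OF g, of x "y + h"]] by simp
    show "norm (\<phi> t *\<^sub>R g t) \<le> h * (indicator {x..y + h} t * norm (g t))" for t
      using \<phi>(3,4)[of t] \<phi>(5)[of t] by (auto simp: indicator_def intro: mult_right_mono)
  qed (use \<open>0 < h\<close> in auto)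
  also have "\<dots> = h * (LINT t|lebesgue. indicator {x..y + h} t * norm (g t))" by simp
  finally show ?thesis .
qed

text \<open>Letting \<open>n\<close> tend to infinity replaces the bumps by indicators. This form, without test functions,
  suits Lebesgue's differentiation theorem, which concerns averages over intervals.\<close>

lemma weak_deriv_box_difference:
  assumes u: "u \<in> L2_real" and g: "g \<in> L2_real" and w: "has_weak_deriv u g"
    and "x < y" "0 < h"
  shows "norm (integral {x..x + h} u - integral {y..y + h} u)
    \<le> h * (LINT t|lebesgue. indicator {x..y + h} t * norm (g t))"
proof -
  have box: "(LINT t|lebesgue. indicator {c<..<c + h} t *\<^sub>R u t) = integral {c..c + h} u" for c
  proof -
    have "set_integrable lebesgue {c..c + h} u"
      using L2_real_integrable_on_interval[OF u] by (simp add: set_integrable_def)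
    then have "set_integrable lebesgue {c<..<c + h} u"
      by (rule set_integrable_subset) auto
    from set_lebesgue_integral_eq_integral(2)[OF this] show ?thesis
      by (simp only: set_lebesgue_integral_def integral_open_interval_real)
  qed
  have "(\<lambda>n. norm ((LINT t|lebesgue. bump h n (t - x) *\<^sub>R u t) - (LINT t|lebesgue. bump h n (t - y) *\<^sub>R u t)))
    \<longlonglongrightarrow> norm (integral {x..x + h} u - integral {y..y + h} u)"
    using tendsto_norm[OF tendsto_diff[OF bump_integral_tendsto[OF u, of h x] bump_integral_tendsto[OF u, of h y]]]
    by (simp only: box)
  then show ?thesis
    by (rule LIMSEQ_le_const2) (intro exI allI impI weak_deriv_bump_difference[OF assms])
qed

lemma L2_real_Cauchy_Schwarz_interval:
  assumes g: "g \<in> L2_real" and "x \<le> z"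
  shows "ennreal ((LINT t|lebesgue. indicator {x..z} t * norm (g t))\<^sup>2)
    \<le> ennreal (z - x) * (\<integral>\<^sup>+t\<in>{x..z}. ennreal ((norm (g t))\<^sup>2) \<partial>lebesgue)"
proof -
  have m: "g \<in> borel_measurable lebesgue" using g by (simp add: L2_real_def)
  have I: "integrable lebesgue (\<lambda>t. indicator {x..z} t * norm (g t))"
    using integrable_norm[OF L2_real_integrable_on_interval[OF g, of x z]] by simp
  have "ennreal (LINT t|lebesgue. indicator {x..z} t * norm (g t))
      = (\<integral>\<^sup>+t. ennreal (indicator {x..z} t * norm (g t)) \<partial>lebesgue)"
    by (rule nn_integral_eq_integral[symmetric, OF I]) simp
  also have "\<dots> = (\<integral>\<^sup>+t. indicator {x..z} t * (ennreal (norm (g t)) * indicator {x..z} t) \<partial>lebesgue)"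
    by (intro nn_integral_cong) (auto simp: indicator_def)
  finally have "ennreal ((LINT t|lebesgue. indicator {x..z} t * norm (g t))\<^sup>2)
      = (\<integral>\<^sup>+t. indicator {x..z} t * (ennreal (norm (g t)) * indicator {x..z} t) \<partial>lebesgue)\<^sup>2"
    by (simp flip: ennreal_power)
  also have "\<dots> \<le> (\<integral>\<^sup>+t. (indicator {x..z} t)\<^sup>2 \<partial>lebesgue)
      * (\<integral>\<^sup>+t. (ennreal (norm (g t)) * indicator {x..z} t)\<^sup>2 \<partial>lebesgue)"
    by (intro Cauchy_Schwarz_nn_integral borel_measurable_times_ennreal borel_measurable_indicator)
       (use m in auto)
  also have "(\<integral>\<^sup>+t. (indicator {x..z} t)\<^sup>2 \<partial>lebesgue) = (\<integral>\<^sup>+t. indicator {x..z} t \<partial>lebesgue)"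
    by (intro nn_integral_cong) (auto simp: indicator_def)
  also have "\<dots> = ennreal (z - x)"
    using \<open>x \<le> z\<close> by (simp add: emeasure_completion)
  also have "(\<integral>\<^sup>+t. (ennreal (norm (g t)) * indicator {x..z} t)\<^sup>2 \<partial>lebesgue)
      = (\<integral>\<^sup>+t\<in>{x..z}. ennreal ((norm (g t))\<^sup>2) \<partial>lebesgue)"
    by (intro nn_integral_cong) (auto simp: indicator_def ennreal_power)
  finally show ?thesis .
qed

text \<open>Dividing the previous estimate by \<open>h\<close> and letting \<open>h\<close> tend to \<open>0\<close> recovers \<open>u x - u y\<close> at all
  Lebesgue points. The margin between \<open>y\<close> and \<open>z\<close> leaves room for the interval \<open>[y, y + h]\<close>, so that
  the right-hand side does not depend on \<open>h\<close>. The square is bounded by the Cauchy-Schwarz inequality.\<close>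

lemma weak_deriv_Hoelder_estimate:
  assumes u: "u \<in> L2_real" and g: "g \<in> L2_real" and w: "has_weak_deriv u g"
  obtains N where "negligible N"
    "\<And>x y z. \<lbrakk>x < y; y < z; x \<notin> N; y \<notin> N\<rbrakk> \<Longrightarrow>
      ennreal ((norm (u x - u y))\<^sup>2) \<le> ennreal (z - x) * (\<integral>\<^sup>+t\<in>{x..z}. ennreal ((norm (g t))\<^sup>2) \<partial>lebesgue)"
proof -
  have "u integrable_on cbox a b" for a b
    using L2_real_integrable_on_interval[OF u, of a b] set_lebesgue_integral_eq_integral(1)[of "{a..b}" u]
    by (simp add: set_integrable_def)
  then obtain N where N: "negligible N" and diff: "\<And>x e. \<lbrakk>x \<notin> N; 0 < e\<rbrakk> \<Longrightarrow>
      \<exists>d>0. \<forall>h. 0 < h \<and> h < d \<longrightarrow> norm (integral {x..x + h} u /\<^sub>R h - u x) < e"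
    using integrable_ccontinuous_explicit[of u] by auto
  show ?thesis
  proof (rule that[OF N])
    fix x y z assume xyz: "x < y" "y < z" "x \<notin> N" "y \<notin> N"
    let ?K = "LINT t|lebesgue. indicator {x..z} t * norm (g t)"
    have "norm (u x - u y) \<le> ?K"
    proof (rule field_le_epsilon)
      fix e :: real assume "e > 0"
      then obtain d1 d2 where d: "d1 > 0" "d2 > 0"
        "\<And>h. 0 < h \<Longrightarrow> h < d1 \<Longrightarrow> norm (integral {x..x + h} u /\<^sub>R h - u x) < e / 2"
        "\<And>h. 0 < h \<Longrightarrow> h < d2 \<Longrightarrow> norm (integral {y..y + h} u /\<^sub>R h - u y) < e / 2"
        using diff[of x "e / 2"] diff[of y "e / 2"] xyz by (metis half_gt_zero)
      \<comment> \<open>small enough for both averages and for \<open>[y, y + h]\<close> to stay left of \<open>z\<close>\<close>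
      define h where "h = min (min d1 d2) (z - y) / 2"
      have h: "0 < h" "h < d1" "h < d2" "y + h \<le> z" using d(1,2) xyz by (auto simp: h_def min_def field_simps)
      have "norm (integral {x..x + h} u /\<^sub>R h - integral {y..y + h} u /\<^sub>R h)
          = norm (integral {x..x + h} u - integral {y..y + h} u) / h"
        using h(1) by (simp add: divide_inverse_commute flip: scaleR_diff_right)
      also have "\<dots> \<le> (LINT t|lebesgue. indicator {x..y + h} t * norm (g t))"
        using weak_deriv_box_difference[OF u g w \<open>x < y\<close> h(1)] h(1) by (simp add: field_simps)
      also have "\<dots> \<le> ?K"
        using integrable_norm[OF L2_real_integrable_on_interval[OF g, of x z]] h(4)
        by (intro integral_mono') (auto simp: indicator_def)
      finally have "norm (integral {x..x + h} u /\<^sub>R h - integral {y..y + h} u /\<^sub>R h) \<le> ?K" .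
      moreover have "norm (u x - u y) \<le> norm (A - u x) + norm (A - B) + norm (B - u y)" for A B
        by norm
      ultimately show "norm (u x - u y) \<le> ?K + e"
        using d(3)[OF h(1,2)] d(4)[OF h(1,3)] by (smt (verit) field_sum_of_halves)
    qed
    then have "ennreal ((norm (u x - u y))\<^sup>2) \<le> ennreal (?K\<^sup>2)"
      by (intro ennreal_leI power_mono) auto
    also have "\<dots> \<le> ennreal (z - x) * (\<integral>\<^sup>+t\<in>{x..z}. ennreal ((norm (g t))\<^sup>2) \<partial>lebesgue)"
      using L2_real_Cauchy_Schwarz_interval[OF g] xyz by simp
    finally show "ennreal ((norm (u x - u y))\<^sup>2)
      \<le> ennreal (z - x) * (\<integral>\<^sup>+t\<in>{x..z}. ennreal ((norm (g t))\<^sup>2) \<partial>lebesgue)" .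
  qed
qed

section \<open>Sums of extended nonnegative numbers and the Loomis-Whitney inequality\<close>

abbreviation esum :: "('a \<Rightarrow> ennreal) \<Rightarrow> ennreal" where
  "esum f \<equiv> nn_integral (count_space UNIV) f"

lemma ennreal_square_root_exists: "\<exists>r::ennreal. r\<^sup>2 = x"
proof (cases x)
  case (real r)
  then have "(ennreal (sqrt r))\<^sup>2 = x" by (simp add: ennreal_power)
  then show ?thesis by blast
next
  case top
  then show ?thesis by (intro exI[of _ top]) (simp add: power2_eq_square ennreal_top_mult)
qed

lemma ennreal_power2_le_imp_le:
  fixes x y :: ennreal
  assumes "x\<^sup>2 \<le> y\<^sup>2" shows "x \<le> y"
proof (cases y)
  case (real s)
  show ?thesis
  proof (cases x)
    case (real r)
    with \<open>y = ennreal s\<close> \<open>0 \<le> s\<close> assms show ?thesis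
      by (simp add: ennreal_power)
  next
    case top
    with \<open>y = ennreal s\<close> \<open>0 \<le> s\<close> assms show ?thesis
      by (simp add: ennreal_power top_unique power2_eq_square ennreal_top_mult ennreal_mult_eq_top_iff)
  qed
qed simp

lemma esum_prod: "esum (\<lambda>x. esum (\<lambda>y. f (x, y))) = esum f"
  by (rule nn_integral_fst_count_space)

lemma esum_reindex: "bij g \<Longrightarrow> esum (\<lambda>x. f (g x)) = esum f"
  by (rule nn_integral_bij_count_space)

lemma Cauchy_Schwarz_esum: "(esum (\<lambda>x. f x * g x))\<^sup>2 \<le> esum (\<lambda>x. (f x)\<^sup>2) * esum (\<lambda>x. (g x)\<^sup>2)"
  by (rule Cauchy_Schwarz_nn_integral) auto

lemma sum_le_esum: "finite S \<Longrightarrow> sum f S \<le> esum f"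
proof -
  assume "finite S"
  then have "sum f S = (\<integral>\<^sup>+x. f x * indicator S x \<partial>count_space UNIV)"
    by (simp add: nn_integral_count_space_finite flip: nn_integral_count_space_indicator)
  also have "\<dots> \<le> esum f" by (intro nn_integral_mono) (auto simp: indicator_def)
  finally show ?thesis .
qed

text \<open>The sum over \<open>z\<close> is estimated by the Cauchy-Schwarz inequality for fixed \<open>x\<close> and \<open>y\<close>, then the sum over the
  pairs \<open>(x, y)\<close>. Square roots are hidden in the form of the hypothesis, which is how the inequality
  is met below: as a bound on a square by a product of three quantities, each independent of one
  coordinate.\<close>

lemma Loomis_Whitney:
  fixes c :: "'a \<Rightarrow> 'b \<Rightarrow> 'c \<Rightarrow> ennreal"
  assumes "\<And>x y z. (c x y z)\<^sup>2 \<le> F y z * G x z * H x y"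
  shows "(esum (\<lambda>x. esum (\<lambda>y. esum (\<lambda>z. c x y z))))\<^sup>2
    \<le> esum (\<lambda>y. esum (\<lambda>z. F y z)) * esum (\<lambda>x. esum (\<lambda>z. G x z)) * esum (\<lambda>x. esum (\<lambda>y. H x y))"
proof -
  obtain root :: "ennreal \<Rightarrow> ennreal" where root: "\<And>t. (root t)\<^sup>2 = t"
    using ennreal_square_root_exists by metis
  define f g h where "f y z = root (F y z)" and "g x z = root (G x z)" and "h x y = root (H x y)" for x y z
  have f: "(f y z)\<^sup>2 = F y z" and g: "(g x z)\<^sup>2 = G x z" and h: "(h x y)\<^sup>2 = H x y" for x y z
    by (simp_all add: f_def g_def h_def root)
  define K where "K x y = esum (\<lambda>z. f y z * g x z)" for x y
  have "esum (\<lambda>x. esum (\<lambda>y. (K x y)\<^sup>2))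
      \<le> esum (\<lambda>x. esum (\<lambda>y. esum (\<lambda>z. F y z) * esum (\<lambda>z. G x z)))"
    unfolding K_def f[symmetric] g[symmetric] by (intro nn_integral_mono Cauchy_Schwarz_esum)
  also have "\<dots> = esum (\<lambda>y. esum (\<lambda>z. F y z)) * esum (\<lambda>x. esum (\<lambda>z. G x z))"
    by (simp add: nn_integral_multc nn_integral_cmult)
  finally have K: "esum (\<lambda>x. esum (\<lambda>y. (K x y)\<^sup>2)) \<le> \<dots>" .
  have "c x y z \<le> h x y * (f y z * g x z)" for x y z
    by (rule ennreal_power2_le_imp_le)
       (use assms[of x y z] in \<open>simp add: power_mult_distrib f g h mult_ac\<close>)
  then have "esum (\<lambda>z. c x y z) \<le> h x y * K x y" for x y
    unfolding K_def by (subst nn_integral_cmult[symmetric]) (auto intro: nn_integral_mono)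
  then have "esum (\<lambda>x. esum (\<lambda>y. esum (\<lambda>z. c x y z))) \<le> esum (\<lambda>x. esum (\<lambda>y. h x y * K x y))"
    by (intro nn_integral_mono)
  also have "\<dots> = esum (\<lambda>(x, y). h x y * K x y)"
    by (simp flip: esum_prod)
  finally have "(esum (\<lambda>x. esum (\<lambda>y. esum (\<lambda>z. c x y z))))\<^sup>2 \<le> (esum (\<lambda>(x, y). h x y * K x y))\<^sup>2"
    by (rule power_mono) simp
  also have "\<dots> \<le> esum (\<lambda>p. (h (fst p) (snd p))\<^sup>2) * esum (\<lambda>p. (K (fst p) (snd p))\<^sup>2)"
    unfolding case_prod_beta by (rule Cauchy_Schwarz_esum)
  also have "\<dots> = esum (\<lambda>x. esum (\<lambda>y. H x y)) * esum (\<lambda>x. esum (\<lambda>y. (K x y)\<^sup>2))"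
    by (simp add: h flip: esum_prod)
  also have "\<dots> \<le> esum (\<lambda>x. esum (\<lambda>y. H x y))
      * (esum (\<lambda>y. esum (\<lambda>z. F y z)) * esum (\<lambda>x. esum (\<lambda>z. G x z)))"
    by (rule mult_left_mono[OF K]) simp
  finally show ?thesis by (simp add: mult_ac)
qed

section \<open>Sobolev's inequality on the integer lattice\<close>

lemma esum_power3_le: "esum (\<lambda>x. (f x)^3) \<le> (esum f)^3"
proof -
  have le: "f x \<le> esum f" for x using sum_le_esum[of "{x}" f] by simp
  have "esum (\<lambda>x. (f x)^3) = esum (\<lambda>x. f x * (f x)\<^sup>2)" by (simp add: power3_eq_cube power2_eq_square mult_ac)
  also have "\<dots> \<le> esum (\<lambda>x. f x * (esum f)\<^sup>2)"
    by (intro nn_integral_mono mult_left_mono power_mono le) auto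
  also have "\<dots> = (esum f)^3" by (simp add: nn_integral_multc power3_eq_cube power2_eq_square mult_ac)
  finally show ?thesis .
qed

text \<open>The increments from \<open>j\<close> onwards telescope to \<open>- \<beta> j\<close>, because \<open>\<beta>\<close> vanishes at infinity.\<close>

lemma telescoping_le_esum:
  fixes \<beta> :: "int \<Rightarrow> real"
  assumes "(\<lambda>n. \<beta> (j + int n)) \<longlonglongrightarrow> 0"
  shows "ennreal (\<beta> j) \<le> esum (\<lambda>i. ennreal \<bar>\<beta> (i + 1) - \<beta> i\<bar>)"
proof -
  let ?F = "esum (\<lambda>i. ennreal \<bar>\<beta> (i + 1) - \<beta> i\<bar>)"
  have "ennreal (\<beta> j) \<le> ?F + ennreal \<bar>\<beta> (j + int n)\<bar>" for n
  proof -
    have "\<beta> j \<le> (\<Sum>k<n. \<bar>\<beta> (j + int k + 1) - \<beta> (j + int k)\<bar>) + \<bar>\<beta> (j + int n)\<bar>"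
      by (induction n) (auto simp: add_ac)
    then have "ennreal (\<beta> j) \<le> ennreal ((\<Sum>k<n. \<bar>\<beta> (j + int k + 1) - \<beta> (j + int k)\<bar>) + \<bar>\<beta> (j + int n)\<bar>)"
      by (rule ennreal_leI)
    also have "\<dots> = (\<Sum>k<n. ennreal \<bar>\<beta> (j + int k + 1) - \<beta> (j + int k)\<bar>) + ennreal \<bar>\<beta> (j + int n)\<bar>"
      by (simp add: sum_nonneg)
    also have "(\<Sum>k<n. ennreal \<bar>\<beta> (j + int k + 1) - \<beta> (j + int k)\<bar>)
        = (\<Sum>i\<in>(\<lambda>k. j + int k) ` {..<n}. ennreal \<bar>\<beta> (i + 1) - \<beta> i\<bar>)"
      by (subst sum.reindex) (auto simp: inj_on_def)
    also have "\<dots> \<le> ?F" by (rule sum_le_esum) simp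
    finally show ?thesis by (simp add: add_right_mono)
  qed
  moreover have "(\<lambda>n. ?F + ennreal \<bar>\<beta> (j + int n)\<bar>) \<longlonglongrightarrow> ?F + ennreal 0"
    by (intro tendsto_add tendsto_const tendsto_ennrealI tendsto_rabs_zero assms)
  ultimately show ?thesis
    by (intro LIMSEQ_le_const[where X = "\<lambda>n. ?F + ennreal \<bar>\<beta> (j + int n)\<bar>"]) auto
qed

lemma esum_finite_imp_tendsto_0:
  fixes \<beta> :: "int \<Rightarrow> real"
  assumes "\<And>i. 0 \<le> \<beta> i" "esum (\<lambda>i. ennreal (\<beta> i)) < \<infinity>"
  shows "(\<lambda>n. \<beta> (j + int n)) \<longlonglongrightarrow> 0"
proof (rule summable_LIMSEQ_zero[OF summableI_nonneg_bounded])
  fix n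
  have "ennreal (\<Sum>k<n. \<beta> (j + int k)) = (\<Sum>i\<in>(\<lambda>k. j + int k) ` {..<n}. ennreal (\<beta> i))"
    using assms(1) by (subst sum.reindex) (auto simp: inj_on_def)
  also have "\<dots> \<le> esum (\<lambda>i. ennreal (\<beta> i))" by (rule sum_le_esum) simp
  finally show "(\<Sum>k<n. \<beta> (j + int k)) \<le> enn2real (esum (\<lambda>i. ennreal (\<beta> i)))"
    using assms by (metis enn2real_ennreal enn2real_mono infinity_ennreal_def sum_nonneg)
qed (use assms in auto)

lemma fourth_power_le_variation:
  fixes \<alpha> :: "int \<Rightarrow> real"
  assumes "\<And>i. 0 \<le> \<alpha> i" "esum (\<lambda>i. ennreal (\<alpha> i ^ 6)) < \<infinity>"
  shows "ennreal (\<alpha> j ^ 4) \<le> esum (\<lambda>i. ennreal \<bar>\<alpha> (i + 1) ^ 4 - \<alpha> i ^ 4\<bar>)"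
proof (rule telescoping_le_esum)
  have "(\<lambda>n. \<alpha> (j + int n) ^ 6) \<longlonglongrightarrow> 0"
    using assms by (intro esum_finite_imp_tendsto_0) auto
  from tendsto_real_root[OF this, of 6] have "(\<lambda>n. \<alpha> (j + int n)) \<longlonglongrightarrow> 0"
    using assms(1) by (simp add: real_root_power_cancel)
  from tendsto_power[OF this, of 4] show "(\<lambda>n. \<alpha> (j + int n) ^ 4) \<longlonglongrightarrow> 0" by simp
qed

lemma abs_diff_power4_le:
  fixes s t :: real
  assumes "0 \<le> s" "0 \<le> t"
  shows "\<bar>s ^ 4 - t ^ 4\<bar> \<le> 2 * (s ^ 3 + t ^ 3) * \<bar>s - t\<bar>"
proof -
  have "s ^ 4 - t ^ 4 = ((s + t) * (s\<^sup>2 + t\<^sup>2)) * (s - t)"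
    by (simp add: power4_eq_xxxx power2_eq_square algebra_simps)
  moreover have "(s + t) * (s\<^sup>2 + t\<^sup>2) \<le> 2 * (s ^ 3 + t ^ 3)"
  proof -
    have "2 * (s ^ 3 + t ^ 3) - (s + t) * (s\<^sup>2 + t\<^sup>2) = (s + t) * (s - t)\<^sup>2"
      by (simp add: power3_eq_cube power2_eq_square algebra_simps)
    also have "\<dots> \<ge> 0" using assms by simp
    finally show ?thesis by simp
  qed
  ultimately show ?thesis
    using assms by (simp add: abs_mult mult_right_mono)
qed

text \<open>The discrete counterpart of \<open>(a\<^sup>4)' = 4 a\<^sup>3 a'\<close> combined with the Cauchy-Schwarz inequality.\<close>

lemma esum_variation_le:
  fixes a b :: "'a \<Rightarrow> real"
  assumes "\<And>v. 0 \<le> a v" "\<And>v. 0 \<le> b v"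
  shows "(esum (\<lambda>v. ennreal \<bar>a v ^ 4 - b v ^ 4\<bar>))\<^sup>2
    \<le> 8 * (esum (\<lambda>v. ennreal (a v ^ 6)) + esum (\<lambda>v. ennreal (b v ^ 6))) * esum (\<lambda>v. ennreal ((a v - b v)\<^sup>2))"
proof -
  have "esum (\<lambda>v. ennreal \<bar>a v ^ 4 - b v ^ 4\<bar>)
      \<le> esum (\<lambda>v. ennreal (2 * (a v ^ 3 + b v ^ 3)) * ennreal \<bar>a v - b v\<bar>)"
    using assms by (intro nn_integral_mono, subst ennreal_mult[symmetric])
      (auto intro!: ennreal_leI order_trans[OF abs_diff_power4_le] simp: distrib_left simp del: ennreal_plus)
  then have "(esum (\<lambda>v. ennreal \<bar>a v ^ 4 - b v ^ 4\<bar>))\<^sup>2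
      \<le> (esum (\<lambda>v. ennreal (2 * (a v ^ 3 + b v ^ 3)) * ennreal \<bar>a v - b v\<bar>))\<^sup>2"
    by (rule power_mono) simp
  also have "\<dots> \<le> esum (\<lambda>v. (ennreal (2 * (a v ^ 3 + b v ^ 3)))\<^sup>2) * esum (\<lambda>v. (ennreal \<bar>a v - b v\<bar>)\<^sup>2)"
    by (rule Cauchy_Schwarz_esum)
  also have "\<dots> = esum (\<lambda>v. ennreal ((2 * (a v ^ 3 + b v ^ 3))\<^sup>2)) * esum (\<lambda>v. ennreal ((a v - b v)\<^sup>2))"
    using assms by (simp add: ennreal_power del: ennreal_plus distrib_left_numeral)
  also have "esum (\<lambda>v. ennreal ((2 * (a v ^ 3 + b v ^ 3))\<^sup>2))
      \<le> esum (\<lambda>v. 8 * (ennreal (a v ^ 6) + ennreal (b v ^ 6)))"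
  proof (intro nn_integral_mono)
    fix v
    have "(2 * (a v ^ 3 + b v ^ 3))\<^sup>2 \<le> 8 * (a v ^ 6 + b v ^ 6)"
      using zero_le_power2[of "a v ^ 3 - b v ^ 3"]
      by (simp add: power2_eq_square algebra_simps flip: power_add)
    then have "ennreal ((2 * (a v ^ 3 + b v ^ 3))\<^sup>2) \<le> ennreal (8 * (a v ^ 6 + b v ^ 6))"
      by (rule ennreal_leI)
    also have "\<dots> = 8 * (ennreal (a v ^ 6) + ennreal (b v ^ 6))"
      using assms by (simp add: ennreal_mult')
    finally show "ennreal ((2 * (a v ^ 3 + b v ^ 3))\<^sup>2) \<le> 8 * (ennreal (a v ^ 6) + ennreal (b v ^ 6))" .
  qed
  also have "\<dots> = 8 * (esum (\<lambda>v. ennreal (a v ^ 6)) + esum (\<lambda>v. ennreal (b v ^ 6)))"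
    by (simp add: nn_integral_cmult nn_integral_add)
  finally show ?thesis by (simp add: mult_right_mono)
qed

text \<open>The fourth power of \<open>a\<close> at a vertex is bounded by its variation along each of the three lines
  through the vertex. Multiplying the three bounds gives \<open>(a\<^sup>6)\<^sup>2 \<le> F G H\<close>, where each factor is
  constant along one direction; this is the hypothesis of the Loomis-Whitney inequality. By
  \<open>esum_variation_le\<close> the squared sum of each of the three factors is at most \<open>16 S\<close> times an energy.
  Altogether \<open>S\<^sup>4\<close> is at most \<open>16\<^sup>3 S\<^sup>3\<close> times the product of the three energies, and \<open>S\<^sup>3\<close> can be
  cancelled because \<open>S\<close> is finite.\<close>

lemma discrete_Sobolev:
  fixes a :: "int \<times> int \<times> int \<Rightarrow> real"
  assumes a: "\<And>v. 0 \<le> a v"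
  defines "S \<equiv> esum (\<lambda>v. ennreal (a v ^ 6))"
  assumes fin: "S < \<infinity>"
  shows "S \<le> 4096 * esum (\<lambda>(i, j, k). ennreal ((a (i + 1, j, k) - a (i, j, k))\<^sup>2))
    * esum (\<lambda>(i, j, k). ennreal ((a (i, j + 1, k) - a (i, j, k))\<^sup>2))
    * esum (\<lambda>(i, j, k). ennreal ((a (i, j, k + 1) - a (i, j, k))\<^sup>2))"
    (is "_ \<le> 4096 * ?E1 * ?E2 * ?E3")
proof -
  define F where "F j k = esum (\<lambda>i. ennreal \<bar>a (i + 1, j, k) ^ 4 - a (i, j, k) ^ 4\<bar>)" for j k
  define G where "G i k = esum (\<lambda>j. ennreal \<bar>a (i, j + 1, k) ^ 4 - a (i, j, k) ^ 4\<bar>)" for i k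
  define H where "H i j = esum (\<lambda>k. ennreal \<bar>a (i, j, k + 1) ^ 4 - a (i, j, k) ^ 4\<bar>)" for i j
  have line: "esum (\<lambda>i. ennreal (a (p i) ^ 6)) < \<infinity>" if "inj p" for p :: "int \<Rightarrow> _"
  proof -
    have "esum (\<lambda>i. ennreal (a (p i) ^ 6)) = (\<integral>\<^sup>+v. ennreal (a v ^ 6) \<partial>count_space (range p))"
      by (rule nn_integral_bij_count_space) (use that in \<open>simp add: bij_betw_def\<close>)
    also have "\<dots> = (\<integral>\<^sup>+v. ennreal (a v ^ 6) * indicator (range p) v \<partial>count_space UNIV)"
      by (rule nn_integral_count_space_indicator) simp
    also have "\<dots> \<le> S" unfolding S_def by (intro nn_integral_mono) (auto simp: indicator_def)
    finally show ?thesis using fin by (rule le_less_trans)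
  qed
  have F: "ennreal (a (i, j, k) ^ 4) \<le> F j k" for i j k
    unfolding F_def using a line[of "\<lambda>i. (i, j, k)"] by (intro fourth_power_le_variation) (auto simp: inj_def)
  have G: "ennreal (a (i, j, k) ^ 4) \<le> G i k" for i j k
    unfolding G_def using a line[of "\<lambda>j. (i, j, k)"] by (intro fourth_power_le_variation) (auto simp: inj_def)
  have H: "ennreal (a (i, j, k) ^ 4) \<le> H i j" for i j k
    unfolding H_def using a line[of "\<lambda>k. (i, j, k)"] by (intro fourth_power_le_variation) (auto simp: inj_def)
  have "(ennreal (a (i, j, k) ^ 6))\<^sup>2 \<le> F j k * G i k * H i j" for i j k
  proof -
    have "(ennreal (a (i, j, k) ^ 6))\<^sup>2 = ennreal (a (i, j, k) ^ 4) * ennreal (a (i, j, k) ^ 4) * ennreal (a (i, j, k) ^ 4)"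
      using a by (simp add: ennreal_power flip: ennreal_mult power_add power_mult)
    also have "\<dots> \<le> F j k * G i k * H i j" by (intro mult_mono F G H) auto
    finally show ?thesis .
  qed
  from Loomis_Whitney[where c = "\<lambda>i j k. ennreal (a (i, j, k) ^ 6)", OF this]
  have LW: "S\<^sup>2 \<le> esum (\<lambda>j. esum (F j)) * esum (\<lambda>i. esum (G i)) * esum (\<lambda>i. esum (H i))"
    by (simp add: S_def flip: esum_prod)
  have step: "(esum (\<lambda>v. ennreal \<bar>a (s v) ^ 4 - a v ^ 4\<bar>))\<^sup>2
      \<le> 16 * S * esum (\<lambda>v. ennreal ((a (s v) - a v)\<^sup>2))" if "bij s" for s
  proof -
    have "esum (\<lambda>v. ennreal (a (s v) ^ 6)) = S"
      unfolding S_def using esum_reindex[OF that, of "\<lambda>v. ennreal (a v ^ 6)"] .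
    then have "8 * (esum (\<lambda>v. ennreal (a (s v) ^ 6)) + esum (\<lambda>v. ennreal (a v ^ 6))) = 16 * S"
      by (simp add: S_def flip: distrib_right)
    then show ?thesis using esum_variation_le[of "\<lambda>v. a (s v)" a] a by simp
  qed
  have perm: "bij (\<lambda>(j, k, i). (i, j, k))" "bij (\<lambda>(i, k, j). (i, j, k))" for i j k :: int
    by (rule bij_betwI[where g = "\<lambda>(i, j, k). (j, k, i)"]; auto)
       (rule bij_betwI[where g = "\<lambda>(i, j, k). (i, k, j)"]; auto)
  have "esum (\<lambda>j. esum (F j)) = esum (\<lambda>(i, j, k). ennreal \<bar>a (i + 1, j, k) ^ 4 - a (i, j, k) ^ 4\<bar>)"
    unfolding F_def by (subst esum_reindex[OF perm(1), symmetric]) (simp flip: esum_prod)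
  then have 1: "(esum (\<lambda>j. esum (F j)))\<^sup>2 \<le> 16 * S * ?E1"
    using step[of "\<lambda>(i, j, k). (i + 1, j, k)"] 
    by (simp add: split_def bij_betwI[where g = "\<lambda>(i, j, k). (i - 1, j, k)"])
  have "esum (\<lambda>i. esum (G i)) = esum (\<lambda>(i, j, k). ennreal \<bar>a (i, j + 1, k) ^ 4 - a (i, j, k) ^ 4\<bar>)"
    unfolding G_def by (subst esum_reindex[OF perm(2), symmetric]) (simp flip: esum_prod)
  then have 2: "(esum (\<lambda>i. esum (G i)))\<^sup>2 \<le> 16 * S * ?E2"
    using step[of "\<lambda>(i, j, k). (i, j + 1, k)"]
    by (simp add: split_def bij_betwI[where g = "\<lambda>(i, j, k). (i, j - 1, k)"])
  have "esum (\<lambda>i. esum (H i)) = esum (\<lambda>(i, j, k). ennreal \<bar>a (i, j, k + 1) ^ 4 - a (i, j, k) ^ 4\<bar>)"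
    unfolding H_def by (simp flip: esum_prod)
  then have 3: "(esum (\<lambda>i. esum (H i)))\<^sup>2 \<le> 16 * S * ?E3"
    using step[of "\<lambda>(i, j, k). (i, j, k + 1)"]
    by (simp add: split_def bij_betwI[where g = "\<lambda>(i, j, k). (i, j, k - 1)"])
  have "S ^ 3 * S = (S\<^sup>2)\<^sup>2" by (simp add: power3_eq_cube power2_eq_square mult_ac)
  also have "\<dots> \<le> (esum (\<lambda>j. esum (F j)) * esum (\<lambda>i. esum (G i)) * esum (\<lambda>i. esum (H i)))\<^sup>2"
    by (rule power_mono[OF LW]) simp
  also have "\<dots> \<le> (16 * S * ?E1) * (16 * S * ?E2) * (16 * S * ?E3)"
    unfolding power_mult_distrib by (intro mult_mono 1 2 3) auto
  also have "\<dots> = S ^ 3 * (4096 * ?E1 * ?E2 * ?E3)"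
    by (simp add: power3_eq_cube algebra_simps)
  finally have "S ^ 3 * S \<le> S ^ 3 * (4096 * ?E1 * ?E2 * ?E3)" .
  then show ?thesis
    using fin by (cases "S = 0") (auto simp: ennreal_mult_le_mult_iff power_eq_top_ennreal)
qed

section \<open>Estimates on an edge\<close>

abbreviation sq_int :: "real set \<Rightarrow> (real \<Rightarrow> complex) \<Rightarrow> ennreal" where
  "sq_int A f \<equiv> (\<integral>\<^sup>+t\<in>A. ennreal ((norm (f t))\<^sup>2) \<partial>lebesgue)"

lemma sq_int_mono: "A \<subseteq> B \<Longrightarrow> sq_int A f \<le> sq_int B f"
  by (intro nn_integral_mono) (auto simp: indicator_def)

lemma power6_add_le:
  fixes p r :: real
  assumes "0 \<le> p" "0 \<le> r"
  shows "(p + r) ^ 6 \<le> 32 * (p ^ 6 + r ^ 6)"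
proof -
  have cube: "(s + t) ^ 3 \<le> 4 * (s ^ 3 + t ^ 3)" if "0 \<le> s" "0 \<le> t" for s t :: real
  proof -
    have "4 * (s ^ 3 + t ^ 3) - (s + t) ^ 3 = 3 * (s + t) * (s - t)\<^sup>2"
      by (simp add: power3_eq_cube power2_eq_square algebra_simps)
    also have "\<dots> \<ge> 0" using that by simp
    finally show ?thesis by simp
  qed
  have "(p + r)\<^sup>2 \<le> 2 * (p\<^sup>2 + r\<^sup>2)"
    using zero_le_power2[of "p - r"] by (simp add: power2_eq_square algebra_simps)
  then have "((p + r)\<^sup>2) ^ 3 \<le> (2 * (p\<^sup>2 + r\<^sup>2)) ^ 3"
    by (rule power_mono) simp
  also have "\<dots> = 8 * (p\<^sup>2 + r\<^sup>2) ^ 3" by (simp add: power_mult_distrib del: distrib_left_numeral)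
  also have "\<dots> \<le> 8 * (4 * ((p\<^sup>2) ^ 3 + (r\<^sup>2) ^ 3))" by (intro mult_left_mono cube) auto
  finally show ?thesis by (simp flip: power_mult)
qed

text \<open>The discriminant of a quadratic polynomial in \<open>h\<close> without sign change. The minimum is at
  \<open>h = X / (4 D)\<close>; for \<open>D = 0\<close> large values of \<open>h\<close> force \<open>X = 0\<close>.\<close>

lemma sq_le_of_quadratic_lower_bound:
  fixes X M D :: real
  assumes "0 \<le> X" "0 \<le> M" "0 \<le> D" and le: "\<And>h. h > 0 \<Longrightarrow> h * X \<le> 2 * M + 2 * h\<^sup>2 * D"
  shows "X\<^sup>2 \<le> 16 * M * D"
proof (cases "X = 0")
  case False
  with assms(1) have X: "X > 0" by simp
  have "D \<noteq> 0"
    using le[of "(2 * M + 1) / X"] X \<open>0 \<le> M\<close> by auto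
  with assms have D: "D > 0" by simp
  have "X / (4 * D) * X \<le> 2 * M + 2 * (X / (4 * D))\<^sup>2 * D" using X D by (intro le) simp
  then show ?thesis using D by (simp add: field_simps power2_eq_square)
qed (use assms in simp)

text \<open>An end point at which \<open>u\<close> is continuous is a limit of points of the open interval outside the null
  set \<open>N\<close>, so the estimate carries over to it, no matter whether the end point itself belongs to \<open>N\<close>.\<close>

lemma edge_oscillation:
  fixes u g :: "real \<Rightarrow> complex"
  assumes N: "negligible N"
    and osc: "\<And>x y z. \<lbrakk>x < y; y < z; x \<notin> N; y \<notin> N\<rbrakk> \<Longrightarrow>
      ennreal ((norm (u x - u y))\<^sup>2) \<le> ennreal (z - x) * sq_int {x..z} g"
    and ab: "a < b" and cont: "isCont u a" "isCont u b"
    and x: "x \<in> {a, b} \<union> ({a<..<b} - N)" and y: "y \<in> {a, b} \<union> ({a<..<b} - N)"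
  shows "ennreal ((norm (u x - u y))\<^sup>2) \<le> ennreal (b - a) * sq_int {a..b} g" (is "_ \<le> ?K")
proof (cases ?K)
  case (real K)
  have interior_less: "ennreal ((norm (u s - u t))\<^sup>2) \<le> ?K" if "s < t" "s \<in> {a<..<b} - N" "t \<in> {a<..<b} - N" for s t
  proof -
    have "ennreal ((norm (u s - u t))\<^sup>2) \<le> ennreal (b - s) * sq_int {s..b} g"
      using that by (intro osc) auto
    also have "\<dots> \<le> ?K" using that by (intro mult_mono sq_int_mono ennreal_leI) auto
    finally show ?thesis .
  qed
  have interior: "norm (u s - u t) \<le> sqrt K" if "s \<in> {a<..<b} - N" "t \<in> {a<..<b} - N" for s t
  proof (rule real_le_rsqrt)
    have "ennreal ((norm (u s - u t))\<^sup>2) \<le> ?K"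
      using interior_less[of s t] interior_less[of t s] that
      by (cases s t rule: linorder_cases) (auto simp: norm_minus_commute)
    then show "(norm (u s - u t))\<^sup>2 \<le> K" using real by simp
  qed
  have approx: "\<exists>s\<in>{a<..<b} - N. norm (u s - u c) < e" if "e > 0" "c \<in> {a, b} \<union> ({a<..<b} - N)" for c e
  proof (cases "c \<in> {a, b}")
    case True
    then have "isCont u c" using cont by auto
    then obtain d where d: "d > 0" "\<And>s. dist s c < d \<Longrightarrow> dist (u s) (u c) < e"
      using \<open>e > 0\<close> by (auto simp: continuous_at_eps_delta)
    have "open (ball c d \<inter> {a<..<b})" by auto
    moreover have "ball c d \<inter> {a<..<b} \<noteq> {}"
    proof -
      have "(if c = a then a + min d (b - a) / 2 else b - min d (b - a) / 2) \<in> ball c d \<inter> {a<..<b}"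
        using True ab d(1) by (auto simp: dist_real_def min_def field_simps)
      then show ?thesis by blast
    qed
    ultimately have "\<not> negligible (ball c d \<inter> {a<..<b})" by (rule open_not_negligible)
    then have "\<not> ball c d \<inter> {a<..<b} \<subseteq> N" using N negligible_subset by blast
    then obtain s where s: "s \<in> ball c d" "s \<in> {a<..<b} - N" by blast
    with d(2)[of s] have "norm (u s - u c) < e" by (simp add: dist_norm abs_minus_commute)
    with s(2) show ?thesis by blast
  qed (use that in \<open>auto intro!: bexI[of _ c]\<close>)
  have "norm (u x - u y) \<le> sqrt K"
  proof (rule field_le_epsilon)
    fix e :: real assume "e > 0"
    then obtain s t where "s \<in> {a<..<b} - N" "t \<in> {a<..<b} - N"
      "norm (u s - u x) < e / 2" "norm (u t - u y) < e / 2"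
      using approx[of "e / 2" x] approx[of "e / 2" y] x y by auto
    moreover have "norm (u x - u y) \<le> norm (u s - u x) + norm (u s - u t) + norm (u t - u y)" by norm
    ultimately show "norm (u x - u y) \<le> sqrt K + e"
      using interior[of s t] by (smt (verit) field_sum_of_halves)
  qed
  then have "(norm (u x - u y))\<^sup>2 \<le> (sqrt K)\<^sup>2" by (rule power_mono) simp
  then show ?thesis using real by simp
qed simp

text \<open>The inequality \<open>|v|\<^sup>2 \<le> 2 |u y|\<^sup>2 + 2 |v - u y|\<^sup>2\<close>, integrated over \<open>y\<close>. It is used with \<open>v\<close> a value
  at a vertex, to make the vertex values square summable, and with \<open>v\<close> the value at an arbitrary
  point of a line, to bound the supremum.\<close>

lemma sq_le_mean_sq:
  assumes m: "u \<in> borel_measurable lebesgue" and ab: "a < b"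
    and osc: "AE y in lebesgue. y \<in> {a..b} \<longrightarrow> ennreal ((norm (v - u y))\<^sup>2) \<le> C"
  shows "ennreal (b - a) * ennreal ((norm v)\<^sup>2) \<le> 2 * sq_int {a..b} u + 2 * (ennreal (b - a) * C)"
proof -
  have "ennreal (b - a) * ennreal ((norm v)\<^sup>2) = (\<integral>\<^sup>+y. ennreal ((norm v)\<^sup>2) * indicator {a..b} y \<partial>lebesgue)"
    using ab by (subst nn_integral_cmult_indicator) (auto simp: emeasure_completion mult.commute)
  also have "\<dots> \<le> (\<integral>\<^sup>+y. 2 * (ennreal ((norm (u y))\<^sup>2) * indicator {a..b} y) + 2 * C * indicator {a..b} y \<partial>lebesgue)"
  proof (rule nn_integral_mono_AE)
    show "AE y in lebesgue. ennreal ((norm v)\<^sup>2) * indicator {a..b} y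
      \<le> 2 * (ennreal ((norm (u y))\<^sup>2) * indicator {a..b} y) + 2 * C * indicator {a..b} y"
      using osc
    proof eventually_elim
      case (elim y)
      show ?case
      proof (cases "y \<in> {a..b}")
        case True
        have "norm v \<le> norm (u y) + norm (v - u y)" by norm
        then have "(norm v)\<^sup>2 \<le> (norm (u y) + norm (v - u y))\<^sup>2" by (rule power_mono) simp
        also have "\<dots> \<le> 2 * (norm (u y))\<^sup>2 + 2 * (norm (v - u y))\<^sup>2"
          using zero_le_power2[of "norm (u y) - norm (v - u y)"]
          by (simp add: power2_eq_square algebra_simps)
        finally have "ennreal ((norm v)\<^sup>2) \<le> ennreal (2 * (norm (u y))\<^sup>2 + 2 * (norm (v - u y))\<^sup>2)"
          by (rule ennreal_leI)
        also have "\<dots> = 2 * ennreal ((norm (u y))\<^sup>2) + 2 * ennreal ((norm (v - u y))\<^sup>2)"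
          by (simp add: ennreal_mult')
        also have "\<dots> \<le> 2 * ennreal ((norm (u y))\<^sup>2) + 2 * C"
          using elim True by (intro add_left_mono mult_left_mono) auto
        finally show ?thesis using True by simp
      qed simp
    qed
  qed
  also have "\<dots> = (\<integral>\<^sup>+y. 2 * (ennreal ((norm (u y))\<^sup>2) * indicator {a..b} y) \<partial>lebesgue)
      + (\<integral>\<^sup>+y. 2 * C * indicator {a..b} y \<partial>lebesgue)"
    using m by (intro nn_integral_add borel_measurable_times_ennreal borel_measurable_indicator) auto
  also have "(\<integral>\<^sup>+y. 2 * (ennreal ((norm (u y))\<^sup>2) * indicator {a..b} y) \<partial>lebesgue) = 2 * sq_int {a..b} u"
    using m by (intro nn_integral_cmult borel_measurable_times_ennreal borel_measurable_indicator) auto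
  also have "(\<integral>\<^sup>+y. 2 * C * indicator {a..b} y \<partial>lebesgue) = 2 * C * ennreal (b - a)"
    using ab by (simp add: nn_integral_cmult_indicator emeasure_completion)
  finally show ?thesis by (simp add: mult_ac)
qed

lemma sixth_power_edge_le:
  assumes l: "l > 0"
    and osc: "AE y in lebesgue. y \<in> {a..a + l} \<longrightarrow> ennreal ((norm (v - u y))\<^sup>2) \<le> ennreal l * e"
  shows "(\<integral>\<^sup>+y\<in>{a..a + l}. ennreal (norm (u y) ^ 6) \<partial>lebesgue)
    \<le> ennreal (32 * l) * ennreal (norm v ^ 6) + ennreal (32 * l ^ 4) * e ^ 3"
proof -
  let ?B = "32 * (ennreal (norm v ^ 6) + (ennreal l * e) ^ 3)"
  have "(\<integral>\<^sup>+y\<in>{a..a + l}. ennreal (norm (u y) ^ 6) \<partial>lebesgue) \<le> (\<integral>\<^sup>+y. ?B * indicator {a..a + l} y \<partial>lebesgue)"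
  proof (rule nn_integral_mono_AE)
    show "AE y in lebesgue. ennreal (norm (u y) ^ 6) * indicator {a..a + l} y \<le> ?B * indicator {a..a + l} y"
      using osc
    proof eventually_elim
      case (elim y)
      show ?case
      proof (cases "y \<in> {a..a + l}")
        case True
        have "norm (u y) \<le> norm v + norm (v - u y)" by norm
        then have "norm (u y) ^ 6 \<le> (norm v + norm (v - u y)) ^ 6" by (rule power_mono) simp
        also have "\<dots> \<le> 32 * (norm v ^ 6 + norm (v - u y) ^ 6)" by (rule power6_add_le) auto
        finally have "ennreal (norm (u y) ^ 6) \<le> ennreal (32 * (norm v ^ 6 + norm (v - u y) ^ 6))"
          by (rule ennreal_leI)
        also have "\<dots> = 32 * (ennreal (norm v ^ 6) + ennreal ((norm (v - u y))\<^sup>2) ^ 3)"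
          by (simp add: ennreal_mult' ennreal_power flip: power_mult)
        also have "\<dots> \<le> ?B"
          using elim True by (intro mult_left_mono add_left_mono power_mono) auto
        finally show ?thesis using True by simp
      qed simp
    qed
  qed
  also have "\<dots> = ?B * ennreal l"
    using l by (simp add: nn_integral_cmult_indicator emeasure_completion)
  also have "\<dots> = ennreal (32 * l) * ennreal (norm v ^ 6) + ennreal (32 * l ^ 4) * e ^ 3"
    using l by (simp add: ennreal_mult' power_mult_distrib ennreal_power[symmetric] power3_eq_cube power4_eq_xxxx algebra_simps)
  finally show ?thesis .
qed

lemma esum_indicator_singleton: "esum (\<lambda>i. c * indicator {j} i) = c"
  by (simp add: nn_integral_cmult_indicator)

text \<open>The closed edges cover the line and overlap only at the countably many vertices.\<close>

lemma nn_integral_eq_esum_edges: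
  fixes f :: "real \<Rightarrow> ennreal"
  assumes f: "f \<in> borel_measurable lebesgue" and l: "l > 0"
  shows "(\<integral>\<^sup>+t. f t \<partial>lebesgue) = esum (\<lambda>i::int. \<integral>\<^sup>+t\<in>{of_int i * l..of_int i * l + l}. f t \<partial>lebesgue)"
proof -
  have "AE t in lebesgue. t \<notin> range (\<lambda>i::int. of_int i * l)"
    by (intro AE_not_in null_sets_completionI countable_imp_null_set_lborel) auto
  then have "AE t in lebesgue. f t = esum (\<lambda>i::int. f t * indicator {of_int i * l..of_int i * l + l} t)"
  proof eventually_elim
    case (elim t)
    have "indicator {of_int i * l..of_int i * l + l} t = (indicator {\<lfloor>t / l\<rfloor>} i :: ennreal)" for i :: int
    proof -
      have "t \<noteq> of_int (i + 1) * l" using elim by blast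
      moreover have "i = \<lfloor>t / l\<rfloor> \<longleftrightarrow> of_int i * l \<le> t \<and> t < of_int i * l + l"
        using l by (auto simp: floor_eq_iff field_simps eq_commute[of i])
      ultimately show ?thesis
        by (auto simp: indicator_def algebra_simps)
    qed
    then show ?case by (simp add: esum_indicator_singleton)
  qed
  then have "(\<integral>\<^sup>+t. f t \<partial>lebesgue)
      = (\<integral>\<^sup>+t. esum (\<lambda>i::int. f t * indicator {of_int i * l..of_int i * l + l} t) \<partial>lebesgue)"
    by (rule nn_integral_cong_AE)
  also have "\<dots> = esum (\<lambda>i::int. \<integral>\<^sup>+t\<in>{of_int i * l..of_int i * l + l}. f t \<partial>lebesgue)"
    using f by (intro nn_integral_count_space_nn_integral borel_measurable_times_ennreal borel_measurable_indicator) auto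
  finally show ?thesis .
qed

section \<open>Estimates on a line\<close>

context
  fixes u g :: "real \<Rightarrow> complex"
  assumes u: "u \<in> L2_real" and g: "g \<in> L2_real" and w: "has_weak_deriv u g"
begin

text \<open>Comparing \<open>u x\<close> with its values on \<open>[x, x + h]\<close> gives
  \<open>h |u x|\<^sup>2 \<le> 2 M + 2 h\<^sup>2 D\<close> for every \<open>h > 0\<close>, where \<open>M\<close> and \<open>D\<close> are the squared norms of \<open>u\<close> and of its
  derivative. Optimising over \<open>h\<close> yields \<open>|u x|\<^sup>4 \<le> 16 M D\<close>, and the remaining factor \<open>|u x|\<^sup>2\<close> is
  integrated.\<close>

lemma L2_real_sixth_power_le:
  "(\<integral>\<^sup>+t. ennreal (norm (u t) ^ 6) \<partial>lebesgue) \<le> 16 * (sq_int UNIV u)\<^sup>2 * sq_int UNIV g"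
proof -
  have fin: "sq_int UNIV f < \<infinity>" if "f \<in> L2_real" for f
    using that integrableD(2)[of lebesgue "\<lambda>t. (norm (f t))\<^sup>2"] by (simp add: L2_real_def less_top)
  obtain M where M: "0 \<le> M" "sq_int UNIV u = ennreal M"
    using fin[OF u] by (cases "sq_int UNIV u") auto
  obtain D where D: "0 \<le> D" "sq_int UNIV g = ennreal D"
    using fin[OF g] by (cases "sq_int UNIV g") auto
  have m: "u \<in> borel_measurable lebesgue" using u by (simp add: L2_real_def)
  obtain N where N: "negligible N"
    "\<And>x y z. \<lbrakk>x < y; y < z; x \<notin> N; y \<notin> N\<rbrakk> \<Longrightarrow>
      ennreal ((norm (u x - u y))\<^sup>2) \<le> ennreal (z - x) * sq_int {x..z} g"
    using weak_deriv_Hoelder_estimate[OF u g w] by blast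
  have N0: "N \<in> null_sets lebesgue" using N(1) by (simp add: negligible_iff_null_sets)
  have bound: "(norm (u x)) ^ 4 \<le> 16 * M * D" if x: "x \<notin> N" for x
  proof -
    have "((norm (u x))\<^sup>2)\<^sup>2 \<le> 16 * M * D"
    proof (rule sq_le_of_quadratic_lower_bound)
      fix h :: real assume h: "h > 0"
      have null: "N \<union> {x, x + h} \<in> null_sets lebesgue"
        by (intro null_sets.Un N0 null_sets_completionI countable_imp_null_set_lborel) simp
      have "AE y in lebesgue. y \<notin> N \<union> {x, x + h}"
        by (rule AE_not_in[OF null])
      then have "AE y in lebesgue. y \<in> {x..x + h} \<longrightarrow> ennreal ((norm (u x - u y))\<^sup>2) \<le> ennreal (h * D)"
      proof eventually_elim
        case (elim y)
        show ?case
        proof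
          assume "y \<in> {x..x + h}"
          with elim x have "ennreal ((norm (u x - u y))\<^sup>2) \<le> ennreal (x + h - x) * sq_int {x..x + h} g"
            by (intro N(2)) auto
          also have "\<dots> \<le> ennreal h * sq_int UNIV g"
            using h by (intro mult_mono sq_int_mono) auto
          finally show "ennreal ((norm (u x - u y))\<^sup>2) \<le> ennreal (h * D)"
            using h D by (simp add: ennreal_mult)
        qed
      qed
      from sq_le_mean_sq[OF m _ this] h
      have "ennreal h * ennreal ((norm (u x))\<^sup>2) \<le> 2 * sq_int {x..x + h} u + 2 * (ennreal h * ennreal (h * D))"
        by simp
      also have "\<dots> \<le> 2 * sq_int UNIV u + 2 * (ennreal h * ennreal (h * D))"
        by (intro add_right_mono mult_left_mono sq_int_mono) auto
      also have "\<dots> = ennreal (2 * M + 2 * h\<^sup>2 * D)"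
        using h M D by (simp add: ennreal_mult' power2_eq_square mult_ac)
      finally show "h * (norm (u x))\<^sup>2 \<le> 2 * M + 2 * h\<^sup>2 * D"
        using h M D by (simp flip: ennreal_mult del: ennreal_plus)
    qed (use M D in auto)
    then show ?thesis by (simp flip: power_mult)
  qed
  have "(\<integral>\<^sup>+t. ennreal (norm (u t) ^ 6) \<partial>lebesgue) \<le> (\<integral>\<^sup>+t. ennreal (16 * M * D) * ennreal ((norm (u t))\<^sup>2) \<partial>lebesgue)"
  proof (rule nn_integral_mono_AE)
    show "AE t in lebesgue. ennreal (norm (u t) ^ 6) \<le> ennreal (16 * M * D) * ennreal ((norm (u t))\<^sup>2)"
      using AE_not_in[OF N0]
    proof eventually_elim
      case (elim t)
      have "norm (u t) ^ 6 = norm (u t) ^ 4 * (norm (u t))\<^sup>2" by (simp flip: power_add)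
      also have "\<dots> \<le> 16 * M * D * (norm (u t))\<^sup>2" by (intro mult_right_mono bound elim) auto
      finally show ?case using M D by (simp add: ennreal_leI flip: ennreal_mult)
    qed
  qed
  also have "\<dots> = ennreal (16 * M * D) * (\<integral>\<^sup>+t. ennreal ((norm (u t))\<^sup>2) \<partial>lebesgue)"
    using m by (intro nn_integral_cmult) auto
  also have "\<dots> = 16 * (sq_int UNIV u)\<^sup>2 * sq_int UNIV g"
    using M D by (simp add: ennreal_mult' power2_eq_square mult_ac)
  finally show ?thesis .
qed

context
  fixes l :: real
  assumes l: "l > 0" and cont: "\<And>i::int. isCont u (of_int i * l)"
begin

lemma edge_estimates:
  fixes i :: int
  defines "a \<equiv> of_int i * l"
  shows "ennreal ((norm (u (a + l)) - norm (u a))\<^sup>2) \<le> ennreal l * sq_int {a..a + l} g"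
    and "ennreal l * ennreal ((norm (u a))\<^sup>2)
      \<le> 2 * sq_int {a..a + l} u + ennreal (2 * l\<^sup>2) * sq_int {a..a + l} g"
    and "(\<integral>\<^sup>+y\<in>{a..a + l}. ennreal (norm (u y) ^ 6) \<partial>lebesgue)
      \<le> ennreal (32 * l) * ennreal (norm (u a) ^ 6) + ennreal (32 * l ^ 4) * (sq_int {a..a + l} g) ^ 3"
proof -
  obtain N where N: "negligible N"
    "\<And>x y z. \<lbrakk>x < y; y < z; x \<notin> N; y \<notin> N\<rbrakk> \<Longrightarrow>
      ennreal ((norm (u x - u y))\<^sup>2) \<le> ennreal (z - x) * sq_int {x..z} g"
    using weak_deriv_Hoelder_estimate[OF u g w] by blast
  have "isCont u a" "isCont u (a + l)"
    using cont[of i] cont[of "i + 1"] by (simp_all add: a_def algebra_simps)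
  note osc = edge_oscillation[of N u g a "a + l", OF N _ this, simplified, OF l]
  have "(norm (u (a + l)) - norm (u a))\<^sup>2 \<le> (norm (u (a + l) - u a))\<^sup>2"
    using norm_triangle_ineq3[of "u (a + l)" "u a"] by (metis abs_norm_cancel power2_abs power_mono abs_ge_zero)
  then have "ennreal ((norm (u (a + l)) - norm (u a))\<^sup>2) \<le> ennreal ((norm (u (a + l) - u a))\<^sup>2)"
    by (rule ennreal_leI)
  also have "\<dots> \<le> ennreal l * sq_int {a..a + l} g" by (rule osc) auto
  finally show "ennreal ((norm (u (a + l)) - norm (u a))\<^sup>2) \<le> ennreal l * sq_int {a..a + l} g" .
  have "AE y in lebesgue. y \<notin> N" using N(1) by (intro AE_not_in) (simp add: negligible_iff_null_sets)
  then have ae: "AE y in lebesgue. y \<in> {a..a + l} \<longrightarrow>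
      ennreal ((norm (u a - u y))\<^sup>2) \<le> ennreal l * sq_int {a..a + l} g"
    by eventually_elim (intro impI osc, auto)
  have m: "u \<in> borel_measurable lebesgue" using u by (simp add: L2_real_def)
  show "ennreal l * ennreal ((norm (u a))\<^sup>2)
      \<le> 2 * sq_int {a..a + l} u + ennreal (2 * l\<^sup>2) * sq_int {a..a + l} g"
    using sq_le_mean_sq[OF m _ ae] l by (simp add: ennreal_mult' power2_eq_square mult_ac)
  show "(\<integral>\<^sup>+y\<in>{a..a + l}. ennreal (norm (u y) ^ 6) \<partial>lebesgue)
      \<le> ennreal (32 * l) * ennreal (norm (u a) ^ 6) + ennreal (32 * l ^ 4) * (sq_int {a..a + l} g) ^ 3"
    by (rule sixth_power_edge_le[OF l ae])
qed

text \<open>Sums of the edge estimates over the edges of a line. In the last one the sum of the cubes of the edge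
  energies is bounded by the cube of their sum.\<close>

lemma line_estimates:
  shows "esum (\<lambda>i::int. ennreal ((norm (u (of_int (i + 1) * l)) - norm (u (of_int i * l)))\<^sup>2))
      \<le> ennreal l * sq_int UNIV g"
    and "ennreal l * esum (\<lambda>i::int. ennreal ((norm (u (of_int i * l)))\<^sup>2))
      \<le> 2 * sq_int UNIV u + ennreal (2 * l\<^sup>2) * sq_int UNIV g"
    and "(\<integral>\<^sup>+t. ennreal (norm (u t) ^ 6) \<partial>lebesgue)
      \<le> ennreal (32 * l) * esum (\<lambda>i::int. ennreal (norm (u (of_int i * l)) ^ 6))
        + ennreal (32 * l ^ 4) * (sq_int UNIV g) ^ 3"
proof -
  have edges: "sq_int UNIV f = esum (\<lambda>i::int. sq_int {of_int i * l..of_int i * l + l} f)" if "f \<in> L2_real" for f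
  proof -
    have "f \<in> borel_measurable lebesgue" using that by (simp add: L2_real_def)
    then have "(\<lambda>t. ennreal ((norm (f t))\<^sup>2)) \<in> borel_measurable lebesgue" by measurable
    from nn_integral_eq_esum_edges[OF this l] show ?thesis by simp
  qed
  let ?e = "\<lambda>i::int. sq_int {of_int i * l..of_int i * l + l} g"
  have "esum (\<lambda>i::int. ennreal ((norm (u (of_int (i + 1) * l)) - norm (u (of_int i * l)))\<^sup>2))
      \<le> esum (\<lambda>i. ennreal l * ?e i)"
    using edge_estimates(1) by (intro nn_integral_mono) (simp add: algebra_simps)
  then show "esum (\<lambda>i::int. ennreal ((norm (u (of_int (i + 1) * l)) - norm (u (of_int i * l)))\<^sup>2))
      \<le> ennreal l * sq_int UNIV g"
    by (simp add: nn_integral_cmult edges[OF g, simplified])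
  have "ennreal l * esum (\<lambda>i::int. ennreal ((norm (u (of_int i * l)))\<^sup>2))
      = esum (\<lambda>i::int. ennreal l * ennreal ((norm (u (of_int i * l)))\<^sup>2))"
    by (simp add: nn_integral_cmult)
  also have "\<dots> \<le> esum (\<lambda>i::int. 2 * sq_int {of_int i * l..of_int i * l + l} u + ennreal (2 * l\<^sup>2) * ?e i)"
    by (intro nn_integral_mono edge_estimates(2))
  also have "\<dots> = 2 * sq_int UNIV u + ennreal (2 * l\<^sup>2) * sq_int UNIV g"
    by (simp add: nn_integral_add nn_integral_cmult edges[OF g, simplified] edges[OF u, simplified])
  finally show "ennreal l * esum (\<lambda>i::int. ennreal ((norm (u (of_int i * l)))\<^sup>2))
      \<le> 2 * sq_int UNIV u + ennreal (2 * l\<^sup>2) * sq_int UNIV g" .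
  have "(\<integral>\<^sup>+t. ennreal (norm (u t) ^ 6) \<partial>lebesgue)
      = esum (\<lambda>i::int. \<integral>\<^sup>+t\<in>{of_int i * l..of_int i * l + l}. ennreal (norm (u t) ^ 6) \<partial>lebesgue)"
    using u l by (intro nn_integral_eq_esum_edges) (auto simp: L2_real_def)
  also have "\<dots> \<le> esum (\<lambda>i::int. ennreal (32 * l) * ennreal (norm (u (of_int i * l)) ^ 6) + ennreal (32 * l ^ 4) * ?e i ^ 3)"
    by (intro nn_integral_mono edge_estimates(3))
  also have "\<dots> = ennreal (32 * l) * esum (\<lambda>i::int. ennreal (norm (u (of_int i * l)) ^ 6))
      + ennreal (32 * l ^ 4) * esum (\<lambda>i. ?e i ^ 3)"
    by (simp add: nn_integral_add nn_integral_cmult)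
  also have "\<dots> \<le> ennreal (32 * l) * esum (\<lambda>i::int. ennreal (norm (u (of_int i * l)) ^ 6))
        + ennreal (32 * l ^ 4) * (sq_int UNIV g) ^ 3"
    unfolding edges[OF g] by (intro add_left_mono mult_left_mono esum_power3_le) simp
  finally show "(\<integral>\<^sup>+t. ennreal (norm (u t) ^ 6) \<partial>lebesgue)
      \<le> ennreal (32 * l) * esum (\<lambda>i::int. ennreal (norm (u (of_int i * l)) ^ 6))
        + ennreal (32 * l ^ 4) * (sq_int UNIV g) ^ 3" .
qed

end

end

section \<open>Lines and vertices of the grid\<close>

text \<open>Sums are rewritten as integrals over counting measures, for which Tonelli's theorem and the
  Cauchy-Schwarz inequality are at hand.\<close>

lemma infsum_eq_esum:
  fixes f :: "'a::countable \<Rightarrow> ennreal"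
  shows "infsum f UNIV = esum f"
proof (rule antisym)
  have inf: "infsum f UNIV = (SUP F\<in>{F. finite F \<and> F \<subseteq> UNIV}. sum f F)"
    by (rule nonneg_infsum_complete) simp
  show "infsum f UNIV \<le> esum f"
    unfolding inf by (intro SUP_least sum_le_esum) simp
  show "esum f \<le> infsum f UNIV"
  proof -
    \<comment> \<open>\<open>f\<close> transported to the natural numbers and extended by \<open>0\<close>, so that its sum is a limit of finite sums\<close>
    define h where "h n = (if n \<in> range (to_nat :: 'a \<Rightarrow> nat) then f (from_nat n) else 0)" for n
    have "esum f = (\<integral>\<^sup>+n. h n \<partial>count_space (range (to_nat :: 'a \<Rightarrow> nat)))"
      using nn_integral_bij_count_space[of "to_nat :: 'a \<Rightarrow> nat" UNIV "range to_nat" h, OF bij_betw_imageI[OF inj_to_nat refl]]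
      by (simp add: h_def rangeI)
    also have "\<dots> = esum h"
      by (rule nn_integral_count_space_eq) (auto simp: h_def)
    also have "\<dots> = (SUP n. \<Sum>i<n. h i)"
      by (simp add: nn_integral_count_space_nat suminf_eq_SUP)
    also have "\<dots> \<le> infsum f UNIV"
    proof (rule SUP_least)
      fix n
      define A where "A = {..<n} \<inter> range (to_nat :: 'a \<Rightarrow> nat)"
      have "(\<Sum>i<n. h i) = (\<Sum>i\<in>A. f (from_nat i))"
        unfolding A_def by (rule sum.mono_neutral_cong_right) (auto simp: h_def)
      also have "\<dots> = sum f (from_nat ` A)"
        by (subst sum.reindex) (auto simp: A_def inj_on_def)
      also have "\<dots> \<le> infsum f UNIV"
        unfolding inf by (rule SUP_upper) (auto simp: A_def)
      finally show "(\<Sum>i<n. h i) \<le> infsum f UNIV" .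
    qed
    finally show ?thesis .
  qed
qed

lemma Lp_norm_pow_eq_esum:
  "Lp_norm_pow p f = (\<Sum>d\<in>{X, Y, Z}. esum (\<lambda>mn. \<integral>\<^sup>+x. ennreal (norm (f d mn x) powr p) \<partial>lebesgue))"
  by (simp add: Lp_norm_pow_def infsum_eq_esum add_ac)

definition direction_L2_sq :: "line_family \<Rightarrow> direction \<Rightarrow> ennreal" where
  "direction_L2_sq f d = esum (\<lambda>mn. sq_int UNIV (f d mn))"

lemma direction_L2_sq_le: "direction_L2_sq f d \<le> Lp_norm_pow 2 f"
proof -
  have "direction_L2_sq f d \<le> (\<Sum>d\<in>{X, Y, Z}. direction_L2_sq f d)" by (cases d) (auto simp: add_ac)
  then show ?thesis by (simp add: Lp_norm_pow_eq_esum direction_L2_sq_def powr_numeral)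
qed

text \<open>Continuity of \<open>\<psi>\<close> at a vertex within the grid restricts to continuity along each line through it.
  The representative chosen by \<open>weak_deriv\<close> is a weak derivative because one exists.\<close>

lemma H1_grid_line:
  assumes "\<psi> \<in> H1_grid l"
  shows "grid_restr l \<psi> d mn \<in> L2_real" "grid_deriv l \<psi> d mn \<in> L2_real"
    "has_weak_deriv (grid_restr l \<psi> d mn) (grid_deriv l \<psi> d mn)"
    and "isCont (grid_restr l \<psi> d mn) (of_int i * l)"
proof -
  have H: "grid_restr l \<psi> d mn \<in> H1_real" using assms unfolding H1_grid_def by blast
  then show "grid_restr l \<psi> d mn \<in> L2_real" by (simp add: H1_real_def)
  have "\<exists>g. g \<in> L2_real \<and> has_weak_deriv (grid_restr l \<psi> d mn) g" using H by (auto simp: H1_real_def)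
  from someI_ex[OF this] show "grid_deriv l \<psi> d mn \<in> L2_real"
    "has_weak_deriv (grid_restr l \<psi> d mn) (grid_deriv l \<psi> d mn)"
    by (simp_all add: grid_deriv_def weak_deriv_def)
  obtain m n where mn: "mn = (m, n)" by fastforce
  have cont: "isCont (grid_line l d mn) t" for t
  proof -
    have "isCont (\<lambda>t. vector [a t, b t, c t] :: real^3) t"
      if "isCont a t" "isCont b t" "isCont c t" for a b c :: "real \<Rightarrow> real"
      unfolding continuous_def
    proof (rule vec_tendstoI)
      fix i :: 3
      show "((\<lambda>t. (vector [a t, b t, c t] :: real^3) $ i) \<longlongrightarrow> (vector [a (netlimit (at t)), b (netlimit (at t)), c (netlimit (at t))] :: real^3) $ i) (at t)"
        using exhaust_3[of i] that by (auto simp: vector_3 continuous_def)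
    qed
    then show ?thesis
      by (cases d) (simp_all add: mn fun_eq_iff grid_line.simps[abs_def])
  qed
  let ?v = "grid_line l d mn (of_int i * l)"
  have "?v \<in> grid_vertices l"
    by (cases d) (force simp: mn grid_vertices_def)+
  then have "continuous (at ?v within grid l) \<psi>" using assms by (simp add: H1_grid_def)
  moreover have "range (grid_line l d mn) \<subseteq> grid l" by (auto simp: grid_def)
  ultimately have "continuous (at ?v within range (grid_line l d mn)) \<psi>"
    by (rule continuous_within_subset)
  with cont have "isCont (\<psi> \<circ> grid_line l d mn) (of_int i * l)"
    by (intro continuous_within_compose) auto
  then show "isCont (grid_restr l \<psi> d mn) (of_int i * l)"
    by (simp add: grid_restr_def o_def)
qed

text \<open>The index of vertex number \<open>i\<close> on the line \<open>mn\<close> in direction \<open>d\<close>. For each \<open>d\<close> every vertex is met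
  exactly once, so a sum over all vertices can be organised by the lines in any of the three directions.\<close>

fun lattice_point :: "direction \<Rightarrow> (int \<times> int) \<times> int \<Rightarrow> int \<times> int \<times> int" where
  "lattice_point X ((j, k), i) = (i, j, k)"
| "lattice_point Y ((i, k), j) = (i, j, k)"
| "lattice_point Z ((i, j), k) = (i, j, k)"

definition vertex :: "real \<Rightarrow> int \<times> int \<times> int \<Rightarrow> real^3" where
  "vertex l = (\<lambda>(i, j, k). vector [of_int i * l, of_int j * l, of_int k * l])"

lemma grid_line_vertex: "grid_line l d mn (of_int i * l) = vertex l (lattice_point d (mn, i))"
  by (cases d; cases mn) (simp_all add: vertex_def)

lemma bij_lattice_point: "bij (lattice_point d)"
proof (cases d)
  case X
  then show ?thesis by (intro bij_betwI[where g = "\<lambda>(i, j, k). ((j, k), i)"]) auto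
next
  case Y
  then show ?thesis by (intro bij_betwI[where g = "\<lambda>(i, j, k). ((i, k), j)"]) auto
next
  case Z
  then show ?thesis by (intro bij_betwI[where g = "\<lambda>(i, j, k). ((i, j), k)"]) auto
qed

lemma esum_along_lines: "esum (\<lambda>mn. esum (\<lambda>i. f (lattice_point d (mn, i)))) = esum f"
  using esum_prod[of "\<lambda>q. f (lattice_point d q)"] esum_reindex[OF bij_lattice_point, of f d] by simp

lemma esum_differences:
  fixes a :: "int \<times> int \<times> int \<Rightarrow> real"
  shows "esum (\<lambda>(i, j, k). ennreal ((a (i + 1, j, k) - a (i, j, k))\<^sup>2))
      = esum (\<lambda>mn. esum (\<lambda>i. ennreal ((a (lattice_point X (mn, i + 1)) - a (lattice_point X (mn, i)))\<^sup>2)))"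
    and "esum (\<lambda>(i, j, k). ennreal ((a (i, j + 1, k) - a (i, j, k))\<^sup>2))
      = esum (\<lambda>mn. esum (\<lambda>i. ennreal ((a (lattice_point Y (mn, i + 1)) - a (lattice_point Y (mn, i)))\<^sup>2)))"
    and "esum (\<lambda>(i, j, k). ennreal ((a (i, j, k + 1) - a (i, j, k))\<^sup>2))
      = esum (\<lambda>mn. esum (\<lambda>i. ennreal ((a (lattice_point Z (mn, i + 1)) - a (lattice_point Z (mn, i)))\<^sup>2)))"
  by (subst esum_along_lines[symmetric, of _ X], auto intro!: nn_integral_cong)
     (subst esum_along_lines[symmetric, of _ Y], auto intro!: nn_integral_cong,
      subst esum_along_lines[symmetric, of _ Z], auto intro!: nn_integral_cong)

section \<open>The two bounds on the sixth power norm\<close>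

lemma Lp_norm_pow_6: "Lp_norm_pow 6 f = (\<Sum>d\<in>{X, Y, Z}. esum (\<lambda>mn. \<integral>\<^sup>+x. ennreal (norm (f d mn x) ^ 6) \<partial>lebesgue))"
  by (simp add: Lp_norm_pow_eq_esum powr_numeral)

lemma Lp_norm_pow_2: "Lp_norm_pow 2 f = (\<Sum>d\<in>{X, Y, Z}. direction_L2_sq f d)"
  by (simp add: Lp_norm_pow_eq_esum direction_L2_sq_def powr_numeral)

context
  fixes l :: real and \<psi> :: "real^3 \<Rightarrow> complex" and u g :: line_family
  assumes l: "l > 0" and \<psi>: "\<psi> \<in> H1_grid l"
  defines u_def: "u \<equiv> grid_restr l \<psi>" and g_def: "g \<equiv> grid_deriv l \<psi>"
begin

lemmas line_H1 = H1_grid_line[OF \<psi>, folded u_def g_def]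

lemma H1_grid_finite: "Lp_norm_pow 2 u < \<infinity>" "Lp_norm_pow 2 g < \<infinity>"
  using \<psi> by (simp_all add: H1_grid_def u_def g_def)

lemma L6_le_one_dimensional: "Lp_norm_pow 6 u \<le> 16 * (Lp_norm_pow 2 u)\<^sup>2 * Lp_norm_pow 2 g"
proof -
  have "esum (\<lambda>mn. \<integral>\<^sup>+x. ennreal (norm (u d mn x) ^ 6) \<partial>lebesgue) \<le> 16 * (Lp_norm_pow 2 u)\<^sup>2 * direction_L2_sq g d" for d
  proof -
    have "(\<integral>\<^sup>+x. ennreal (norm (u d mn x) ^ 6) \<partial>lebesgue)
        \<le> 16 * (Lp_norm_pow 2 u)\<^sup>2 * sq_int UNIV (g d mn)" for mn
    proof -
      have "sq_int UNIV (u d mn) \<le> direction_L2_sq u d"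
        unfolding direction_L2_sq_def using sum_le_esum[of "{mn}" "\<lambda>mn. sq_int UNIV (u d mn)"] by simp
      then have "sq_int UNIV (u d mn) \<le> Lp_norm_pow 2 u" using direction_L2_sq_le by (rule order_trans)
      then have "16 * (sq_int UNIV (u d mn))\<^sup>2 * sq_int UNIV (g d mn)
          \<le> 16 * (Lp_norm_pow 2 u)\<^sup>2 * sq_int UNIV (g d mn)"
        by (intro mult_right_mono mult_left_mono power_mono) auto
      with L2_real_sixth_power_le[OF line_H1(1-3), of d mn] show ?thesis
        by (rule order_trans)
    qed
    then have "esum (\<lambda>mn. \<integral>\<^sup>+x. ennreal (norm (u d mn x) ^ 6) \<partial>lebesgue)
        \<le> esum (\<lambda>mn. 16 * (Lp_norm_pow 2 u)\<^sup>2 * sq_int UNIV (g d mn))"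
      by (rule nn_integral_mono)
    also have "\<dots> = 16 * (Lp_norm_pow 2 u)\<^sup>2 * direction_L2_sq g d"
      unfolding direction_L2_sq_def by (rule nn_integral_cmult) simp
    finally show ?thesis .
  qed
  then show ?thesis
    unfolding Lp_norm_pow_6 Lp_norm_pow_2[of g] sum_distrib_left by (intro sum_mono)
qed

text \<open>The sum of \<open>a\<^sup>6\<close> over the vertices is at most \<open>4096 l\<^sup>3 D\<^sup>3\<close> by \<open>discrete_Sobolev\<close>, since the
  differences in each direction have energy at most \<open>l D\<close>. Each of the three directions then contributes
  at most \<open>32 l (4096 l\<^sup>3 D\<^sup>3) + 32 l\<^sup>4 D\<^sup>3\<close>, and \<open>3 (32 * 4096 + 32) = 393312\<close>.\<close>

lemma L6_le_three_dimensional: "Lp_norm_pow 6 u \<le> ennreal (393312 * l ^ 4) * (Lp_norm_pow 2 g) ^ 3"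
proof -
  \<comment> \<open>only the moduli of the vertex values enter; their differences are bounded by the differences of the values\<close>
  define a where "a v = norm (\<psi> (vertex l v))" for v
  have a_line: "norm (u d mn (of_int i * l)) = a (lattice_point d (mn, i))" for d mn i
    by (simp add: u_def grid_restr_def grid_line_vertex a_def)
  note line = line_estimates[OF line_H1(1-3) l line_H1(4), unfolded a_line]
  let ?S = "esum (\<lambda>v. ennreal (a v ^ 6))"
  have diff: "esum (\<lambda>mn. esum (\<lambda>i. ennreal ((a (lattice_point d (mn, i + 1)) - a (lattice_point d (mn, i)))\<^sup>2)))
      \<le> ennreal l * Lp_norm_pow 2 g" for d
  proof -
    have "esum (\<lambda>mn. esum (\<lambda>i. ennreal ((a (lattice_point d (mn, i + 1)) - a (lattice_point d (mn, i)))\<^sup>2)))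
        \<le> esum (\<lambda>mn. ennreal l * sq_int UNIV (g d mn))"
      by (intro nn_integral_mono line(1))
    also have "\<dots> = ennreal l * direction_L2_sq g d"
      unfolding direction_L2_sq_def by (rule nn_integral_cmult) simp
    also have "\<dots> \<le> ennreal l * Lp_norm_pow 2 g" by (intro mult_left_mono direction_L2_sq_le) simp
    finally show ?thesis .
  qed
  \<comment> \<open>vertex values are square summable because \<open>\<psi>\<close> itself is square integrable; the lines in direction \<open>X\<close> already meet every vertex\<close>
  have "?S < \<infinity>"
  proof -
    have "ennreal l * esum (\<lambda>v. ennreal ((a v)\<^sup>2))
        = esum (\<lambda>mn. ennreal l * esum (\<lambda>i. ennreal ((a (lattice_point X (mn, i)))\<^sup>2)))"
      by (simp add: nn_integral_cmult esum_along_lines[of "\<lambda>v. ennreal ((a v)\<^sup>2)"])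
    also have "\<dots> \<le> esum (\<lambda>mn. 2 * sq_int UNIV (u X mn) + ennreal (2 * l\<^sup>2) * sq_int UNIV (g X mn))"
      by (intro nn_integral_mono line(2))
    also have "\<dots> = 2 * direction_L2_sq u X + ennreal (2 * l\<^sup>2) * direction_L2_sq g X"
      unfolding direction_L2_sq_def by (simp add: nn_integral_add nn_integral_cmult)
    also have "\<dots> < \<infinity>"
      using H1_grid_finite direction_L2_sq_le[of u X] direction_L2_sq_le[of g X] by (auto simp: ennreal_mult_less_top)
    finally have "esum (\<lambda>v. ennreal ((a v)\<^sup>2)) < \<infinity>"
      using l by (auto simp: ennreal_mult_less_top)
    then have "(esum (\<lambda>v. ennreal ((a v)\<^sup>2))) ^ 3 < \<infinity>" by (simp add: power_less_top_ennreal)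
    moreover have "?S = esum (\<lambda>v. ennreal ((a v)\<^sup>2) ^ 3)"
      by (simp add: ennreal_power a_def flip: power_mult)
    ultimately show ?thesis
      using esum_power3_le[of "\<lambda>v. ennreal ((a v)\<^sup>2)"] by simp
  qed
  have "0 \<le> a v" for v by (simp add: a_def)
  note discrete_Sobolev[OF this \<open>?S < \<infinity>\<close>, unfolded esum_differences]
  also have "4096 * esum (\<lambda>mn. esum (\<lambda>i. ennreal ((a (lattice_point X (mn, i + 1)) - a (lattice_point X (mn, i)))\<^sup>2)))
      * esum (\<lambda>mn. esum (\<lambda>i. ennreal ((a (lattice_point Y (mn, i + 1)) - a (lattice_point Y (mn, i)))\<^sup>2)))
      * esum (\<lambda>mn. esum (\<lambda>i. ennreal ((a (lattice_point Z (mn, i + 1)) - a (lattice_point Z (mn, i)))\<^sup>2)))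
      \<le> 4096 * (ennreal l * Lp_norm_pow 2 g) * (ennreal l * Lp_norm_pow 2 g) * (ennreal l * Lp_norm_pow 2 g)"
    by (intro mult_mono diff) auto
  also have "\<dots> = ennreal (4096 * l ^ 3) * (Lp_norm_pow 2 g) ^ 3"
    using l by (simp add: ennreal_mult' power3_eq_cube mult_ac)
  finally have S: "?S \<le> ennreal (4096 * l ^ 3) * (Lp_norm_pow 2 g) ^ 3" .
  have "esum (\<lambda>mn. \<integral>\<^sup>+x. ennreal (norm (u d mn x) ^ 6) \<partial>lebesgue)
      \<le> ennreal (32 * l) * ?S + ennreal (32 * l ^ 4) * (Lp_norm_pow 2 g) ^ 3" for d
  proof -
    have "esum (\<lambda>mn. \<integral>\<^sup>+x. ennreal (norm (u d mn x) ^ 6) \<partial>lebesgue)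
        \<le> esum (\<lambda>mn. ennreal (32 * l) * esum (\<lambda>i. ennreal (a (lattice_point d (mn, i)) ^ 6))
            + ennreal (32 * l ^ 4) * (sq_int UNIV (g d mn)) ^ 3)"
      by (intro nn_integral_mono line(3))
    also have "\<dots> = ennreal (32 * l) * ?S + ennreal (32 * l ^ 4) * esum (\<lambda>mn. (sq_int UNIV (g d mn)) ^ 3)"
      by (simp add: nn_integral_add nn_integral_cmult esum_along_lines[of "\<lambda>v. ennreal (a v ^ 6)"])
    also have "\<dots> \<le> ennreal (32 * l) * ?S + ennreal (32 * l ^ 4) * (direction_L2_sq g d) ^ 3"
      unfolding direction_L2_sq_def by (intro add_left_mono mult_left_mono esum_power3_le) simp
    also have "\<dots> \<le> ennreal (32 * l) * ?S + ennreal (32 * l ^ 4) * (Lp_norm_pow 2 g) ^ 3"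
      by (intro add_left_mono mult_left_mono power_mono direction_L2_sq_le) auto
    finally show ?thesis .
  qed
  then have "Lp_norm_pow 6 u \<le> (\<Sum>d\<in>{X, Y, Z}. ennreal (32 * l) * ?S + ennreal (32 * l ^ 4) * (Lp_norm_pow 2 g) ^ 3)"
    unfolding Lp_norm_pow_6 by (intro sum_mono)
  also have "\<dots> \<le> (\<Sum>d\<in>{X, Y, Z}. ennreal (32 * l) * (ennreal (4096 * l ^ 3) * (Lp_norm_pow 2 g) ^ 3)
      + ennreal (32 * l ^ 4) * (Lp_norm_pow 2 g) ^ 3)"
    by (intro sum_mono add_right_mono mult_left_mono S) auto
  also have "\<dots> = (\<Sum>d\<in>{X, Y, Z}. ennreal (131104 * l ^ 4) * (Lp_norm_pow 2 g) ^ 3)"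
  proof -
    have "131104 * l ^ 4 = 32 * l * (4096 * l ^ 3) + 32 * l ^ 4"
      by (simp add: power3_eq_cube power4_eq_xxxx)
    moreover have "ennreal (32 * l * (4096 * l ^ 3) + 32 * l ^ 4) = ennreal (32 * l * (4096 * l ^ 3)) + ennreal (32 * l ^ 4)"
      using l by (intro ennreal_plus) auto
    moreover have "ennreal (32 * l * (4096 * l ^ 3)) = ennreal (32 * l) * ennreal (4096 * l ^ 3)"
      using l by (intro ennreal_mult) auto
    ultimately show ?thesis by (simp only: distrib_right mult.assoc)
  qed
  also have "\<dots> = 3 * (ennreal (131104 * l ^ 4) * (Lp_norm_pow 2 g) ^ 3)"
    by simp
  also have "\<dots> = ennreal (393312 * l ^ 4) * (Lp_norm_pow 2 g) ^ 3"
    using l by (simp add: ennreal_mult' flip: mult.assoc)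
  finally show ?thesis .
qed

end

section \<open>Interpolation\<close>

text \<open>Hoelder's inequality in additive form: Young's inequality is applied pointwise, and sums and integrals
  are then linear. The multiplicative form results when \<open>\<alpha>\<close> and \<open>\<beta>\<close> are the second and sixth
  power integrals of \<open>f\<close>, or upper bounds for them.\<close>

lemma Lp_norm_pow_Young:
  fixes \<alpha> \<beta> \<theta> p :: real
  assumes pos: "\<alpha> > 0" "\<beta> > 0" and \<theta>: "0 \<le> \<theta>" "\<theta> \<le> 1" and p: "p = 2 * (1 - \<theta>) + 6 * \<theta>"
    and m: "\<And>d mn. f d mn \<in> borel_measurable lebesgue"
  shows "Lp_norm_pow p f \<le> ennreal (\<alpha> powr (1 - \<theta>) * \<beta> powr \<theta>)
    * (ennreal ((1 - \<theta>) / \<alpha>) * Lp_norm_pow 2 f + ennreal (\<theta> / \<beta>) * Lp_norm_pow 6 f)"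
proof -
  let ?c = "\<alpha> powr (1 - \<theta>) * \<beta> powr \<theta>"
  have young: "x powr p \<le> ?c * ((1 - \<theta>) / \<alpha> * x powr 2 + \<theta> / \<beta> * x powr 6)" if "x \<ge> 0" for x
  proof (cases "x = 0")
    case False
    with that have x: "x > 0" by simp
    have "x powr p = ?c * ((x powr 2 / \<alpha>) powr (1 - \<theta>) * (x powr 6 / \<beta>) powr \<theta>)"
    proof -
      have "x powr p = x powr (2 * (1 - \<theta>)) * x powr (6 * \<theta>)" by (simp only: p powr_add)
      moreover have "(x powr 2 / \<alpha>) powr (1 - \<theta>) = x powr (2 * (1 - \<theta>)) / \<alpha> powr (1 - \<theta>)"
        "(x powr 6 / \<beta>) powr \<theta> = x powr (6 * \<theta>) / \<beta> powr \<theta>"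
        using x pos by (simp_all add: powr_divide powr_powr del: powr_numeral)
      ultimately show ?thesis using pos by simp
    qed
    also have "\<dots> \<le> ?c * ((1 - \<theta>) * (x powr 2 / \<alpha>) + \<theta> * (x powr 6 / \<beta>))"
      using x pos \<theta> by (intro mult_left_mono Youngs_inequality_0) auto
    finally show ?thesis by simp
  qed simp
  have distr: "ennreal (c * (A * s + B * t)) = ennreal c * (ennreal A * ennreal s + ennreal B * ennreal t)"
    if "0 \<le> c" "0 \<le> A" "0 \<le> s" "0 \<le> B" "0 \<le> t" for c A s B t :: real
    using that by (simp add: ennreal_mult)
  have line: "(\<integral>\<^sup>+x. ennreal (norm (f d mn x) powr p) \<partial>lebesgue)
      \<le> ennreal ?c * (ennreal ((1 - \<theta>) / \<alpha>) * (\<integral>\<^sup>+x. ennreal (norm (f d mn x) powr 2) \<partial>lebesgue)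
        + ennreal (\<theta> / \<beta>) * (\<integral>\<^sup>+x. ennreal (norm (f d mn x) powr 6) \<partial>lebesgue))" for d mn
  proof -
    have meas[measurable]: "f d mn \<in> borel_measurable lebesgue" by (rule m)
    have "(\<integral>\<^sup>+x. ennreal (norm (f d mn x) powr p) \<partial>lebesgue)
      \<le> (\<integral>\<^sup>+x. ennreal ?c * (ennreal ((1 - \<theta>) / \<alpha>) * ennreal (norm (f d mn x) powr 2)
        + ennreal (\<theta> / \<beta>) * ennreal (norm (f d mn x) powr 6)) \<partial>lebesgue)"
    proof (rule nn_integral_mono)
      fix x
      have "ennreal (norm (f d mn x) powr p)
          \<le> ennreal (?c * ((1 - \<theta>) / \<alpha> * norm (f d mn x) powr 2 + \<theta> / \<beta> * norm (f d mn x) powr 6))"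
        by (intro ennreal_leI young) simp
      also have "\<dots> = ennreal ?c * (ennreal ((1 - \<theta>) / \<alpha>) * ennreal (norm (f d mn x) powr 2)
        + ennreal (\<theta> / \<beta>) * ennreal (norm (f d mn x) powr 6))"
        using pos \<theta> by (intro distr) auto
      finally show "ennreal (norm (f d mn x) powr p) \<le> \<dots>" .
    qed
    also have "\<dots> = ennreal ?c * (ennreal ((1 - \<theta>) / \<alpha>) * (\<integral>\<^sup>+x. ennreal (norm (f d mn x) powr 2) \<partial>lebesgue)
        + ennreal (\<theta> / \<beta>) * (\<integral>\<^sup>+x. ennreal (norm (f d mn x) powr 6) \<partial>lebesgue))"
      by (simp add: nn_integral_cmult nn_integral_add)
    finally show ?thesis .
  qed
  have "Lp_norm_pow p f \<le> (\<Sum>d\<in>{X, Y, Z}. esum (\<lambda>mn. ennreal ?c *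
      (ennreal ((1 - \<theta>) / \<alpha>) * (\<integral>\<^sup>+x. ennreal (norm (f d mn x) powr 2) \<partial>lebesgue)
        + ennreal (\<theta> / \<beta>) * (\<integral>\<^sup>+x. ennreal (norm (f d mn x) powr 6) \<partial>lebesgue))))"
    unfolding Lp_norm_pow_eq_esum by (intro sum_mono nn_integral_mono line)
  also have "\<dots> = ennreal ?c * (ennreal ((1 - \<theta>) / \<alpha>) * Lp_norm_pow 2 f + ennreal (\<theta> / \<beta>) * Lp_norm_pow 6 f)"
    unfolding Lp_norm_pow_eq_esum by (simp add: nn_integral_cmult nn_integral_add algebra_simps)
  finally show ?thesis .
qed

lemma powr_interpolation_identity:
  fixes K M D \<theta> :: real
  assumes "K > 0" "M > 0" "D > 0"
  shows "M powr (1 - \<theta>) * ((K * D ^ 3) powr ((1 - \<theta>) / 2) * (16 * M\<^sup>2 * D) powr (\<theta> - (1 - \<theta>) / 2))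
    = K powr ((1 - \<theta>) / 2) * 16 powr (\<theta> - (1 - \<theta>) / 2) * M powr (2 * \<theta>) * D"
proof -
  have D3: "D ^ 3 = D powr 3" and M2: "M\<^sup>2 = M powr 2" using assms by (simp_all add: powr_numeral)
  have "M powr (1 - \<theta>) * ((K * D ^ 3) powr ((1 - \<theta>) / 2) * (16 * M\<^sup>2 * D) powr (\<theta> - (1 - \<theta>) / 2))
    = K powr ((1 - \<theta>) / 2) * 16 powr (\<theta> - (1 - \<theta>) / 2)
      * (M powr (1 - \<theta>) * M powr (2 * (\<theta> - (1 - \<theta>) / 2)))
      * (D powr (3 * ((1 - \<theta>) / 2)) * D powr (\<theta> - (1 - \<theta>) / 2))"
    unfolding D3 M2 using assms by (simp add: powr_mult powr_powr mult_ac del: powr_numeral)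
  also have "M powr (1 - \<theta>) * M powr (2 * (\<theta> - (1 - \<theta>) / 2)) = M powr (2 * \<theta>)"
    unfolding powr_add[symmetric] by (rule arg_cong[where f = "\<lambda>r. M powr r"]) (simp add: field_simps)
  also have "D powr (3 * ((1 - \<theta>) / 2)) * D powr (\<theta> - (1 - \<theta>) / 2) = D powr 1"
    unfolding powr_add[symmetric] by (rule arg_cong[where f = "\<lambda>r. D powr r"]) (simp add: field_simps)
  finally show ?thesis using assms by simp
qed

text \<open>With \<open>s = (1 - \<theta>) / 2\<close> the bounds on \<open>T\<close> are combined to
  \<open>T powr \<theta> \<le> (K D\<^sup>3) powr s * (16 M\<^sup>2 D) powr (\<theta> - s)\<close>; the hypothesis \<open>1 / 3 \<le> \<theta>\<close> makes the second
  exponent nonnegative. Young's inequality is applied with \<open>\<alpha> = M\<close> and with this bound for \<open>\<beta>\<close>. If \<open>M\<close> or \<open>D\<close> vanishes then so does \<open>T\<close>, and these choices of \<open>\<alpha>\<close> and \<open>\<beta>\<close> would not be positive;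
  sending \<open>\<beta>\<close> to \<open>0\<close> in Young's inequality shows that the left-hand side vanishes.\<close>

lemma Lp_norm_pow_interpolation:
  fixes K M D T \<theta> p :: real
  assumes \<theta>: "1 / 3 \<le> \<theta>" "\<theta> \<le> 1" and p: "p = 2 * (1 - \<theta>) + 6 * \<theta>"
    and m: "\<And>d mn. f d mn \<in> borel_measurable lebesgue"
    and nonneg: "0 < K" "0 \<le> M" "0 \<le> D" "0 \<le> T"
    and M: "Lp_norm_pow 2 f = ennreal M" and T: "Lp_norm_pow 6 f = ennreal T"
    and T1: "T \<le> 16 * M\<^sup>2 * D" and T3: "T \<le> K * D ^ 3"
  shows "Lp_norm_pow p f
    \<le> ennreal (K powr ((1 - \<theta>) / 2) * 16 powr (\<theta> - (1 - \<theta>) / 2) * M powr (2 * \<theta>) * D)"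
proof -
  have \<theta>0: "0 \<le> \<theta>" "0 < \<theta>" using \<theta> by auto
  have Young: "Lp_norm_pow p f \<le> ennreal (\<alpha> powr (1 - \<theta>) * \<beta> powr \<theta> * ((1 - \<theta>) / \<alpha> * M + \<theta> / \<beta> * T))"
    if "\<alpha> > 0" "\<beta> > 0" for \<alpha> \<beta>
    using Lp_norm_pow_Young[where f = f, OF that \<theta>0(1) \<theta>(2) p m] that \<theta> nonneg
    by (simp add: M T ennreal_mult' del: times_divide_eq_left)
  show ?thesis
  proof (cases "M = 0 \<or> D = 0")
    case True
    with T1 \<open>0 \<le> T\<close> have "T = 0" by auto
    have "Lp_norm_pow p f \<le> 0 + ennreal e" if "e > 0" for e
    proof -
      \<comment> \<open>\<open>M + 1\<close> instead of \<open>M\<close>, which may be \<open>0\<close>\<close>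
      define \<beta> where "\<beta> = (e / (M + 1)) powr (1 / \<theta>)"
      have "\<beta> > 0" and \<beta>: "\<beta> powr \<theta> = e / (M + 1)"
        using that nonneg \<theta>0 by (simp_all add: \<beta>_def powr_powr)
      have "Lp_norm_pow p f \<le> ennreal (\<beta> powr \<theta> * ((1 - \<theta>) * M))"
        using Young[of 1 \<beta>] \<open>\<beta> > 0\<close> \<open>T = 0\<close> by simp
      also have "\<beta> powr \<theta> * ((1 - \<theta>) * M) \<le> e"
      proof -
        have "(1 - \<theta>) * M \<le> 1 * (M + 1)" using \<theta>0 \<theta> nonneg by (intro mult_mono) auto
        then have "e / (M + 1) * ((1 - \<theta>) * M) \<le> e / (M + 1) * (1 * (M + 1))"
          using that nonneg by (intro mult_left_mono) auto
        then show ?thesis using nonneg by (simp add: \<beta>)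
      qed
      finally show ?thesis by (simp add: ennreal_leI)
    qed
    then have "Lp_norm_pow p f \<le> 0" by (rule ennreal_le_epsilon)
    then show ?thesis by simp
  next
    case False
    with nonneg have MD: "M > 0" "D > 0" by auto
    define s where "s = (1 - \<theta>) / 2"
    have s: "0 \<le> s" "s \<le> \<theta>" using \<theta> by (auto simp: s_def)
    \<comment> \<open>the combined upper bound on \<open>T\<close>\<close>
    define \<beta> where "\<beta> = ((K * D ^ 3) powr s * (16 * M\<^sup>2 * D) powr (\<theta> - s)) powr (1 / \<theta>)"
    have \<beta>: "\<beta> > 0" "\<beta> powr \<theta> = (K * D ^ 3) powr s * (16 * M\<^sup>2 * D) powr (\<theta> - s)"
      using \<theta>0 nonneg MD by (simp_all add: \<beta>_def powr_powr)
    have "T powr \<theta> \<le> \<beta> powr \<theta>"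
    proof -
      have "T powr \<theta> = T powr s * T powr (\<theta> - s)" by (simp flip: powr_add)
      also have "\<dots> \<le> \<beta> powr \<theta>"
        unfolding \<beta>(2) using s nonneg T1 T3 by (intro mult_mono powr_mono2) auto
      finally show ?thesis .
    qed
    then have "T \<le> \<beta>" using \<beta>(1) \<theta>0 \<open>0 \<le> T\<close> by (meson not_le powr_less_mono2 less_imp_le)
    have "Lp_norm_pow p f \<le> ennreal (M powr (1 - \<theta>) * \<beta> powr \<theta> * ((1 - \<theta>) / M * M + \<theta> / \<beta> * T))"
      by (rule Young[OF MD(1) \<beta>(1)])
    also have "\<dots> \<le> ennreal (M powr (1 - \<theta>) * \<beta> powr \<theta> * 1)"
    proof (intro ennreal_leI mult_left_mono)
      have "\<theta> / \<beta> * T \<le> \<theta>" using \<open>T \<le> \<beta>\<close> \<beta>(1) \<theta>0 by (simp add: field_simps)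
      then show "(1 - \<theta>) / M * M + \<theta> / \<beta> * T \<le> 1" using MD by simp
    qed simp
    also have "M powr (1 - \<theta>) * \<beta> powr \<theta> * 1
        = K powr ((1 - \<theta>) / 2) * 16 powr (\<theta> - (1 - \<theta>) / 2) * M powr (2 * \<theta>) * D"
      using powr_interpolation_identity[OF nonneg(1) MD, of \<theta>] by (simp add: \<beta>(2) s_def)
    finally show ?thesis .
  qed
qed

theorem proposition3p4:
  fixes l p :: real
  assumes "l > 0" and "p \<in> {10/3..6}"
  shows "\<exists>C>0. \<forall>\<psi>\<in>H1_grid l.
    Lp_norm_pow p (grid_restr l \<psi>)
      \<le> ennreal (C * L2_norm (grid_restr l \<psi>) powr (p - 2) * (L2_norm (grid_deriv l \<psi>))\<^sup>2)"
proof -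
  define \<theta> where "\<theta> = (p - 2) / 4"
  have \<theta>: "1 / 3 \<le> \<theta>" "\<theta> \<le> 1" and p: "p = 2 * (1 - \<theta>) + 6 * \<theta>"
    using assms(2) by (auto simp: \<theta>_def field_simps)
  define K where "K = 393312 * l ^ 4"
  define C where "C = K powr ((1 - \<theta>) / 2) * 16 powr (\<theta> - (1 - \<theta>) / 2)"
  have K: "K > 0" using assms(1) by (simp add: K_def)
  show ?thesis
  proof (intro exI conjI ballI)
    show "C > 0" using K by (simp add: C_def)
    fix \<psi> assume \<psi>: "\<psi> \<in> H1_grid l"
    let ?u = "grid_restr l \<psi>" and ?g = "grid_deriv l \<psi>"
    obtain M where M: "0 \<le> M" "Lp_norm_pow 2 ?u = ennreal M"
      using H1_grid_finite(1)[OF assms(1) \<psi>] by (cases "Lp_norm_pow 2 ?u") auto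
    obtain D where D: "0 \<le> D" "Lp_norm_pow 2 ?g = ennreal D"
      using H1_grid_finite(2)[OF assms(1) \<psi>] by (cases "Lp_norm_pow 2 ?g") auto
    have T1: "Lp_norm_pow 6 ?u \<le> ennreal (16 * M\<^sup>2 * D)"
      using L6_le_one_dimensional[OF assms(1) \<psi>] M D by (simp add: ennreal_mult' ennreal_power)
    then obtain T where T: "0 \<le> T" "Lp_norm_pow 6 ?u = ennreal T"
      by (cases "Lp_norm_pow 6 ?u") (auto simp: top_unique)
    have T3: "Lp_norm_pow 6 ?u \<le> ennreal (K * D ^ 3)"
      using L6_le_three_dimensional[OF assms(1) \<psi>] D K by (simp add: ennreal_mult ennreal_power K_def)
    have "Lp_norm_pow p ?u \<le> ennreal (C * M powr (2 * \<theta>) * D)"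
      unfolding C_def
    proof (rule Lp_norm_pow_interpolation[OF \<theta> p _ K M(1) D(1) T(1) M(2) T(2)])
      show "?u d mn \<in> borel_measurable lebesgue" for d mn
        using H1_grid_line(1)[OF \<psi>, of d mn] by (simp add: L2_real_def)
      show "T \<le> 16 * M\<^sup>2 * D" using T1 T M D by simp
      show "T \<le> K * D ^ 3" using T3 T K D by simp
    qed
    also have "M powr (2 * \<theta>) = L2_norm ?u powr (p - 2)"
    proof -
      have exponent: "2 * \<theta> = (p - 2) / 2" by (simp add: \<theta>_def)
      show ?thesis
        unfolding exponent using M by (simp add: L2_norm_def powr_half_sqrt[symmetric] powr_powr)
    qed
    also have "D = (L2_norm ?g)\<^sup>2"
      using D by (simp add: L2_norm_def)
    finally show "Lp_norm_pow p ?u \<le> ennreal (C * L2_norm ?u powr (p - 2) * (L2_norm ?g)\<^sup>2)" .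
  qed
qed

end
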